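(* Let $G$ be a group admitting a weakly acylindrical action on a simplicial tree $T$. Then $G$ has trivial positive theory, i.e. $G$ satisfies exactly the same positive sentences as a non-abelian free group.
   Context: A positive sentence in the language of groups is a first-order sentence without negations, i.e. of the form $\forall x_1\exists y_1\dots\forall x_n\exists y_n\ \bigvee_{i=1}^r\bigwedge_{j=1}^s \Sigma_{i,j}(x_1,y_1,\dots,x_n,y_n)=1$ with $\Sigma_{i,j}$ words in $F(x_1,y_1,\dots,x_n,y_n)$ (tuples of variables allowed). The positive theory $Th^+(G)$ is the set of positive sentences true in $G$; $G$ has trivial positive theory if $Th^+(G)=Th^+(F_2)$, where $F_2$ is the free group of rank 2. Let $G$ act on a simplicial tree $T$ without inversions and fix a vertex $v$. An $o$-geodesic is an oriented geodesic segment of $T$ both of whose endpoints lie in the orbit $G\cdot v$; its $o$-length $|J|_o$ is $\#(J\cap G\cdot v)-1$; $J^{op}$ denotes $J$ with the reverse orientation. Let $\mathcal E^{(n)}$ be the set of $o$-geodesics of $o$-length $n$. A labelling is a pair $(k,f)$ with $k$ a positive integer and $f:\mathcal E^{(k)}\to\{a,b,c\}$ a $G$-invariant map. It is good if $f^{-1}(a)$ and $f^{-1}(b)$ each consist of finitely many $G$-orbits and at least one of: (i) $f^{-1}(a)$ is a single $G$-orbit and $f^{-1}(b)$ is a single $G$-orbit; (ii) $f(J)=a$ implies $f(J^{op})\neq b$. For $N\ge k$ and $J\in\mathcal E^{(N)}$, let $J_1,\dots,J_{N-k+1}$ be the $o$-geodesics of $o$-length $k$ contained in $J$, with the orientation of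 $J$, ordered from left to right, and set $f^*(J)=f(J_1)f(J_2)\cdots f(J_{N-k+1})$, a word in $\{a,b,c\}$. For a finite sequence $\bar e=(e_1,\dots,e_q)$ of positive integers let $u_{\bar e}(a,b)=ab^{e_1}ab^{e_2}\cdots ab^{e_q}a$. A minimal action (no proper invariant subtree) of $G$ on a simplicial tree $T$ without inversions is weakly acylindrical if $T$ is not a line, the action admits a good labelling $(k,f)$, and for every finite sequence $\bar e$ of positive integers there exists an $o$-geodesic $J$ with $f^*(J)=u_{\bar e}(a,b)$. *)

theory Defs
  imports "HOL-Algebra.Group_Action"
begin

text \<open>A letter (b, i) denotes the variable number i (inverted if b = True).
  Variables are numbered by the position of the quantifier binding them.\<close>
type_synonym pword = "(bool \<times> nat) list"

datatype quant = QAll | QEx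

text \<open>A positive sentence in prenex form: a quantifier prefix and a matrix in
  disjunctive normal form (list of disjuncts, each a list of equations w = 1).\<close>
type_synonym psent = "quant list \<times> pword list list"

definition positive_sentence :: "psent \<Rightarrow> bool" where
  "positive_sentence s \<longleftrightarrow>
     (\<forall>C\<in>set (snd s). \<forall>w\<in>set C. \<forall>l\<in>set w. snd l < length (fst s))"

definition eval_word :: "('g, 'b) monoid_scheme \<Rightarrow> (nat \<Rightarrow> 'g) \<Rightarrow> pword \<Rightarrow> 'g" where
  "eval_word G \<rho> w =
     foldr (\<lambda>l acc. (if fst l then inv\<^bsub>G\<^esub> (\<rho> (snd l)) else \<rho> (snd l)) \<otimes>\<^bsub>G\<^esub> acc) w \<one>\<^bsub>G\<^esub>"

definition holds_matrix :: "('g, 'b) monoid_scheme \<Rightarrow> (nat \<Rightarrow> 'g) \<Rightarrow> pword list list \<Rightarrow> bool" where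
  "holds_matrix G \<rho> D \<longleftrightarrow> (\<exists>C\<in>set D. \<forall>w\<in>set C. eval_word G \<rho> w = \<one>\<^bsub>G\<^esub>)"

fun sat :: "('g, 'b) monoid_scheme \<Rightarrow> quant list \<Rightarrow> nat \<Rightarrow> (nat \<Rightarrow> 'g) \<Rightarrow> pword list list \<Rightarrow> bool" where
  "sat G [] n \<rho> D = holds_matrix G \<rho> D"
| "sat G (QAll # qs) n \<rho> D = (\<forall>x\<in>carrier G. sat G qs (Suc n) (\<rho>(n := x)) D)"
| "sat G (QEx # qs) n \<rho> D = (\<exists>x\<in>carrier G. sat G qs (Suc n) (\<rho>(n := x)) D)"

definition holds :: "('g, 'b) monoid_scheme \<Rightarrow> psent \<Rightarrow> bool" where
  "holds G s = sat G (fst s) 0 (\<lambda>_. \<one>\<^bsub>G\<^esub>) (snd s)"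

text \<open>A letter (b, g): generator g (False = a, True = b), inverted iff b.\<close>
type_synonym f2letter = "bool \<times> bool"

fun free_red :: "f2letter list \<Rightarrow> f2letter list" where
  "free_red [] = []"
| "free_red (x # xs) = (case free_red xs of
       [] \<Rightarrow> [x]
     | y # ys \<Rightarrow> (if fst y \<noteq> fst x \<and> snd y = snd x then ys else x # y # ys))"

definition F2 :: "f2letter list monoid" where
  "F2 = \<lparr>carrier = {w. free_red w = w}, mult = (\<lambda>x y. free_red (x @ y)), one = []\<rparr>"

definition trivial_positive_theory :: "('g, 'b) monoid_scheme \<Rightarrow> bool" where
  "trivial_positive_theory G \<longleftrightarrow>
     (\<forall>s. positive_sentence s \<longrightarrow> (holds G s \<longleftrightarrow> holds F2 s))"

text \<open>A graph is given by a vertex set V and a symmetric irreflexive set E of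
  oriented edges (pairs of adjacent vertices).\<close>
definition walk :: "('v \<times> 'v) set \<Rightarrow> 'v list \<Rightarrow> bool" where
  "walk E xs \<longleftrightarrow> xs \<noteq> [] \<and> (\<forall>i. Suc i < length xs \<longrightarrow> (xs ! i, xs ! Suc i) \<in> E)"

definition connected_in :: "'v set \<Rightarrow> ('v \<times> 'v) set \<Rightarrow> bool" where
  "connected_in W E \<longleftrightarrow>
     (\<forall>u\<in>W. \<forall>w\<in>W. \<exists>xs. walk E xs \<and> set xs \<subseteq> W \<and> hd xs = u \<and> last xs = w)"

definition simplicial_tree :: "'v set \<Rightarrow> ('v \<times> 'v) set \<Rightarrow> bool" where
  "simplicial_tree V E \<longleftrightarrow>
     V \<noteq> {} \<and> E \<subseteq> V \<times> V \<and> sym E \<and> (\<forall>u. (u, u) \<notin> E) \<and> connected_in V E \<and>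
     (\<forall>xs. walk E xs \<and> (\<forall>i. i + 2 < length xs \<longrightarrow> xs ! i \<noteq> xs ! (i + 2)) \<longrightarrow> distinct xs)"

definition is_line :: "'v set \<Rightarrow> ('v \<times> 'v) set \<Rightarrow> bool" where
  "is_line V E \<longleftrightarrow> (\<forall>u\<in>V. card {w. (u, w) \<in> E} = 2)"

definition tree_action_wo_inv ::
  "('g, 'b) monoid_scheme \<Rightarrow> 'v set \<Rightarrow> ('v \<times> 'v) set \<Rightarrow> ('g \<Rightarrow> 'v \<Rightarrow> 'v) \<Rightarrow> bool" where
  "tree_action_wo_inv G V E \<phi> \<longleftrightarrow>
     group_action G V \<phi> \<and>
     (\<forall>g\<in>carrier G. \<forall>u w. (u, w) \<in> E \<longrightarrow> (\<phi> g u, \<phi> g w) \<in> E) \<and>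
     (\<forall>g\<in>carrier G. \<forall>u w. (u, w) \<in> E \<longrightarrow> \<not> (\<phi> g u = w \<and> \<phi> g w = u))"

definition minimal_action ::
  "('g, 'b) monoid_scheme \<Rightarrow> 'v set \<Rightarrow> ('v \<times> 'v) set \<Rightarrow> ('g \<Rightarrow> 'v \<Rightarrow> 'v) \<Rightarrow> bool" where
  "minimal_action G V E \<phi> \<longleftrightarrow>
     \<not> (\<exists>W. W \<noteq> {} \<and> W \<subset> V \<and> connected_in W E \<and> (\<forall>g\<in>carrier G. \<phi> g ` W \<subseteq> W))"

definition vorbit :: "('g, 'b) monoid_scheme \<Rightarrow> ('g \<Rightarrow> 'v \<Rightarrow> 'v) \<Rightarrow> 'v \<Rightarrow> 'v set" where
  "vorbit G \<phi> v = {\<phi> g v | g. g \<in> carrier G}"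

text \<open>An oriented geodesic segment is a list of vertices forming a path (in a
  tree, paths are exactly the geodesics); orientation = order of the list.\<close>
definition o_geodesic ::
  "('g, 'b) monoid_scheme \<Rightarrow> 'v set \<Rightarrow> ('v \<times> 'v) set \<Rightarrow> ('g \<Rightarrow> 'v \<Rightarrow> 'v) \<Rightarrow> 'v \<Rightarrow> 'v list \<Rightarrow> bool" where
  "o_geodesic G V E \<phi> v J \<longleftrightarrow>
     walk E J \<and> distinct J \<and> set J \<subseteq> V \<and>
     hd J \<in> vorbit G \<phi> v \<and> last J \<in> vorbit G \<phi> v"

definition o_length :: "('g, 'b) monoid_scheme \<Rightarrow> ('g \<Rightarrow> 'v \<Rightarrow> 'v) \<Rightarrow> 'v \<Rightarrow> 'v list \<Rightarrow> nat" where
  "o_length G \<phi> v J = card (set J \<inter> vorbit G \<phi> v) - 1"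

definition o_geods ::
  "('g, 'b) monoid_scheme \<Rightarrow> 'v set \<Rightarrow> ('v \<times> 'v) set \<Rightarrow> ('g \<Rightarrow> 'v \<Rightarrow> 'v) \<Rightarrow> 'v \<Rightarrow> nat \<Rightarrow> 'v list set" where
  "o_geods G V E \<phi> v n = {J. o_geodesic G V E \<phi> v J \<and> o_length G \<phi> v J = n}"

datatype label = La | Lb | Lc

definition geod_orbit :: "('g, 'b) monoid_scheme \<Rightarrow> ('g \<Rightarrow> 'v \<Rightarrow> 'v) \<Rightarrow> 'v list \<Rightarrow> 'v list set" where
  "geod_orbit G \<phi> J = {map (\<phi> g) J | g. g \<in> carrier G}"

definition label_orbits ::
  "('g, 'b) monoid_scheme \<Rightarrow> 'v set \<Rightarrow> ('v \<times> 'v) set \<Rightarrow> ('g \<Rightarrow> 'v \<Rightarrow> 'v) \<Rightarrow> 'v \<Rightarrow> nat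
   \<Rightarrow> ('v list \<Rightarrow> label) \<Rightarrow> label \<Rightarrow> 'v list set set" where
  "label_orbits G V E \<phi> v k f c = geod_orbit G \<phi> ` {J \<in> o_geods G V E \<phi> v k. f J = c}"

definition good_labelling ::
  "('g, 'b) monoid_scheme \<Rightarrow> 'v set \<Rightarrow> ('v \<times> 'v) set \<Rightarrow> ('g \<Rightarrow> 'v \<Rightarrow> 'v) \<Rightarrow> 'v \<Rightarrow> nat
   \<Rightarrow> ('v list \<Rightarrow> label) \<Rightarrow> bool" where
  "good_labelling G V E \<phi> v k f \<longleftrightarrow>
     0 < k \<and>
     (\<forall>g\<in>carrier G. \<forall>J\<in>o_geods G V E \<phi> v k. f (map (\<phi> g) J) = f J) \<and>
     finite (label_orbits G V E \<phi> v k f La) \<and>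
     finite (label_orbits G V E \<phi> v k f Lb) \<and>
     ((card (label_orbits G V E \<phi> v k f La) = 1 \<and> card (label_orbits G V E \<phi> v k f Lb) = 1)
      \<or> (\<forall>J\<in>o_geods G V E \<phi> v k. f J = La \<longrightarrow> f (rev J) \<noteq> Lb))"

definition o_positions :: "('g, 'b) monoid_scheme \<Rightarrow> ('g \<Rightarrow> 'v \<Rightarrow> 'v) \<Rightarrow> 'v \<Rightarrow> 'v list \<Rightarrow> nat list" where
  "o_positions G \<phi> v J = filter (\<lambda>i. J ! i \<in> vorbit G \<phi> v) [0..<length J]"

definition segment :: "'v list \<Rightarrow> nat \<Rightarrow> nat \<Rightarrow> 'v list" where
  "segment J a b = take (Suc b - a) (drop a J)"

definition fstar ::
  "('g, 'b) monoid_scheme \<Rightarrow> ('g \<Rightarrow> 'v \<Rightarrow> 'v) \<Rightarrow> 'v \<Rightarrow> nat \<Rightarrow> ('v list \<Rightarrow> label) \<Rightarrow> 'v list \<Rightarrow> label list" where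
  "fstar G \<phi> v k f J =
     (let p = o_positions G \<phi> v J in
      map (\<lambda>j. f (segment J (p ! j) (p ! (j + k)))) [0..<o_length G \<phi> v J - k + 1])"

definition u_word :: "nat list \<Rightarrow> label list" where
  "u_word es = La # concat (map (\<lambda>e. replicate e Lb @ [La]) es)"

definition weakly_acylindrical ::
  "('g, 'b) monoid_scheme \<Rightarrow> 'v set \<Rightarrow> ('v \<times> 'v) set \<Rightarrow> ('g \<Rightarrow> 'v \<Rightarrow> 'v) \<Rightarrow> bool" where
  "weakly_acylindrical G V E \<phi> \<longleftrightarrow>
     minimal_action G V E \<phi> \<and> \<not> is_line V E \<and>
     (\<exists>v\<in>V. \<exists>k f. good_labelling G V E \<phi> v k f \<and>
        (\<forall>es. (\<forall>e\<in>set es. 0 < e) \<longrightarrow>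
           (\<exists>N J. k \<le> N \<and> J \<in> o_geods G V E \<phi> v N \<and> fstar G \<phi> v k f J = u_word es)))"

end

theory Submission
  imports Defs
begin

text \<open>Attach to \<open>g\<close> the word of labels read, in both directions, along the path from \<open>v\<close> to \<open>g v\<close>.
  Give every label pattern $a b^{2t} a b^{2t+1} a$ a value in an arbitrary group \<open>H\<close> and multiply the
  values (or their inverses) of its forward (or backward) occurrences along the path. This is a map
  from \<open>G\<close> to \<open>H\<close> that respects inversion, and it respects the product of \<open>g\<close> and \<open>h\<close> unless a
  pattern with nontrivial value occurs across the centre of the tripod spanned by \<open>v\<close>, \<open>g v\<close>,
  \<open>g h v\<close>; only boundedly many patterns do that. Play a positive sentence true in \<open>G\<close> with universal
  variables whose words are $u_{\bar e}$ with many exponents, all larger than anything seen before.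
  By pigeonhole each universal variable carries a pattern that crosses none of the tripods arising
  from the equations. Giving that pattern the value chosen by the opponent in \<open>H\<close>, the map turns
  the play in \<open>G\<close> into a winning play in \<open>H\<close>. So all groups satisfy every positive sentence true in
  \<open>G\<close>; since the free group of rank 2 has labels of the same kind, the converse follows as well.\<close>

section \<open>Marked words\<close>

text \<open>A letter will hold the labels of a window and of its reverse. Walking a path backwards
  lists the windows in the opposite order and exchanges the two labels of each.\<close>

definition opp :: "('a \<times> 'a) list \<Rightarrow> ('a \<times> 'a) list" where
  "opp D = rev (map prod.swap D)"

lemma length_opp [simp]: "length (opp D) = length D"
  by (simp add: opp_def)

lemma opp_opp [simp]: "opp (opp D) = D"
  by (simp add: opp_def rev_map o_def)

lemma opp_append [simp]: "opp (P @ Q) = opp Q @ opp P"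
  by (simp add: opp_def)

lemma set_opp: "set (opp D) = prod.swap ` set D"
  by (simp add: opp_def)

lemma nth_opp: "q < length D \<Longrightarrow> opp D ! q = prod.swap (D ! (length D - Suc q))"
  by (simp add: opp_def rev_nth)

text \<open>\<open>fwd D p t\<close>: the first components of \<open>D\<close> read the pattern of type \<open>t\<close>, namely
  $a b^{2t} a b^{2t+1} a$, with its middle \<open>a\<close> at position \<open>p\<close>; \<open>bwd\<close> is the same for \<open>opp D\<close>.
  The two exponents differ so that a pattern is never its own reversal.\<close>

definition fwd :: "(label \<times> label) list \<Rightarrow> nat \<Rightarrow> nat \<Rightarrow> bool" where
  "fwd D p t \<longleftrightarrow> 2*t+1 \<le> p \<and> p+2*t+2 < length D \<and>
     (\<forall>q. p \<le> q+2*t+1 \<longrightarrow> q \<le> p+2*t+2 \<longrightarrow>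
        fst (D ! q) = (if q+2*t+1 = p \<or> q = p \<or> q = p+2*t+2 then La else Lb))"

definition bwd :: "(label \<times> label) list \<Rightarrow> nat \<Rightarrow> nat \<Rightarrow> bool" where
  "bwd D p t \<longleftrightarrow> p < length D \<and> fwd (opp D) (length D - 1 - p) t"

text \<open>The letters of \<open>D\<close> will be pairs $(f(K), f(K^{op}))$; the first disjunct is condition (ii) of
  a good labelling, and the second is what remains of condition (i) when (ii) fails.\<close>

definition coherent :: "(label \<times> label) set \<Rightarrow> bool" where
  "coherent A \<longleftrightarrow> (La, Lb) \<notin> A \<and> (Lb, La) \<notin> A \<or>
     (\<forall>x\<in>A. (fst x = La \<longleftrightarrow> snd x = Lb) \<and> (fst x = Lb \<longleftrightarrow> snd x = La))"

lemma coherent_mono: "coherent A \<Longrightarrow> B \<subseteq> A \<Longrightarrow> coherent B"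
  by (auto simp: coherent_def)

lemma coherent_opp [simp]: "coherent (set (opp D)) \<longleftrightarrow> coherent (set D)"
proof -
  have "coherent (prod.swap ` A)" if "coherent A" for A
    using that by (auto simp: coherent_def)
  from this[of "set D"] this[of "set (opp D)"] show ?thesis
    by (auto simp: set_opp image_image)
qed

text \<open>Mirror image of \<open>fwdD\<close> in the coordinates of \<open>D\<close>: the block of
  length \<open>2*t+1\<close> now lies left of the middle \<open>p\<close> and the block of length
  \<open>2*t\<close> right of it.\<close>

lemma bwdD:
  assumes "bwd D p t" "p \<le> q+2*t+2" "q \<le> p+2*t+1"
  shows "q < length D"
    "snd (D ! q) = (if q+2*t+2 = p \<or> q = p \<or> q = p+2*t+1 then La else Lb)"
proof -
  from assms have f: "fwd (opp D) (length D - 1 - p) t" "p < length D" by (auto simp: bwd_def)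
  then obtain c where c: "length D = p + c + 1" by (metis Suc_eq_plus1 add_Suc_right less_natE)
  with f have f': "fwd (opp D) c t" by simp
  then have b: "2*t+1 \<le> c" "c+2*t+2 < length D" by (auto simp: fwd_def)
  then show q: "q < length D" using assms c by linarith
  then obtain d where d: "length D = q + d + 1" by (metis Suc_eq_plus1 add_Suc_right less_natE)
  have "fst (opp D ! d) = (if d+2*t+1 = c \<or> d = c \<or> d = c+2*t+2 then La else Lb)"
    using f' assms(2,3) c d unfolding fwd_def by simp
  moreover have "opp D ! d = prod.swap (D ! q)"
    using d by (simp add: nth_opp)
  moreover have "d+2*t+1 = c \<longleftrightarrow> q = p+2*t+1" "d = c \<longleftrightarrow> q = p" "d = c+2*t+2 \<longleftrightarrow> q+2*t+2 = p"
    using c d by linarith+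
  ultimately show "snd (D ! q) = (if q+2*t+2 = p \<or> q = p \<or> q = p+2*t+1 then La else Lb)"
    by (simp add: disj_commute disj_left_commute)
qed

lemma fwdD:
  assumes "fwd D p t" "p \<le> q+2*t+1" "q \<le> p+2*t+2"
  shows "q < length D"
    "fst (D ! q) = (if q+2*t+1 = p \<or> q = p \<or> q = p+2*t+2 then La else Lb)"
  using assms by (auto simp: fwd_def)

lemma fwd_bounds: "fwd D p t \<Longrightarrow> 2*t+1 \<le> p" "fwd D p t \<Longrightarrow> p+2*t+2 < length D"
  by (auto simp: fwd_def)

text \<open>Among the first labels, the next \<open>La\<close> after the middle \<open>p\<close>
  stands at \<open>p+2*t+2\<close>, and this determines \<open>t\<close>.\<close>

lemma fwd_unique:
  assumes "fwd D p t" "fwd D p t'"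
  shows "t = t'"
proof -
  have "\<not> t < t'" if "fwd D p t" "fwd D p t'" for t t'
  proof
    assume "t < t'"
    then show False
      using fwdD[OF that(1), of "p + 2*t+2"] fwdD[OF that(2), of "p+2*t+2"] by auto
  qed
  with assms show ?thesis by (metis linorder_neqE_nat)
qed

lemma bwd_unique: "bwd D p t \<Longrightarrow> bwd D p t' \<Longrightarrow> t = t'"
  unfolding bwd_def using fwd_unique by blast

text \<open>The middle letter would be \<open>(La, La)\<close>, which only the first alternative of
  coherence allows. To the right of \<open>p\<close>, the next \<open>La\<close> among the first
  labels is at even distance and among the second labels at odd distance, so the nearer one is
  paired with an \<open>Lb\<close>, which coherence forbids.\<close>

lemma fwd_not_bwd:
  assumes c: "coherent (set D)" and f: "fwd D p t" and b: "bwd D p t'"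
  shows False
proof -
  have p: "p < length D" "fst (D ! p) = La" "snd (D ! p) = La"
    using fwdD[OF f, of p] bwdD[OF b, of p] by auto
  then have "D ! p \<in> set D" by simp
  with p c have "(La, Lb) \<notin> set D \<and> (Lb, La) \<notin> set D"
    unfolding coherent_def by auto
  then have no: "\<not> (fst (D ! q) = La \<and> snd (D ! q) = Lb)" "\<not> (fst (D ! q) = Lb \<and> snd (D ! q) = La)"
    if "q < length D" for q
    using nth_mem[OF that] by (metis prod.collapse)+
  consider "2*t+2 < 2*t'+1" | "2*t'+1 < 2*t+2" by atomize_elim presburger
  then show False
  proof cases
    case 1
    then show False
      using fwdD[OF f, of "p+2*t+2"] bwdD[OF b, of "p+2*t+2"] no[of "p+2*t+2"] by auto
  next
    case 2
    then show False
      using fwdD[OF f, of "p+2*t'+1"] bwdD[OF b, of "p+2*t'+1"] no[of "p+2*t'+1"] by auto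
  qed
qed

text \<open>Occurrences of different types share at most their final letter: the exponents
  \<open>2t\<close> and \<open>2t+1\<close> determine \<open>t\<close> and their parity tells the two blocks apart.\<close>

lemma fwd_disjoint:
  assumes f: "fwd D p t" and f': "fwd D p' t'" and "t \<noteq> t'"
    and "p \<le> z+2*t+1" "z < p+2*t+2" "p' \<le> z+2*t'+1" "z < p'+2*t'+2"
  shows False
proof -
  \<comment> \<open>By symmetry the occurrence at \<open>p'\<close> starts no earlier than the one
    at \<open>p\<close>. Its first letter \<open>s\<close> precedes the final letter of the other
    one, so it is the first or the middle \<open>La\<close> there. In the first case the blocks of
    lengths \<open>2*t\<close> and \<open>2*t'\<close> conflict, in the second those of lengths
    \<open>2*t+1\<close> and \<open>2*t'\<close>.\<close>
  have main: False if f: "fwd D p t" and f': "fwd D p' t'" and "t \<noteq> t'"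
    and "p + 2*t' \<le> p' + 2*t" "p' < p+2*t+2*t'+3" for p p' t t'
  proof -
    have b: "2*t+1 \<le> p" "2*t'+1 \<le> p'" using f f' fwd_bounds by auto
    then obtain s where p': "p' = s+2*t'+1" using le_Suc_ex by (metis add.assoc add.commute)
    have "fst (D ! s) = La" using fwdD(2)[OF f', of s] p' by simp
    then have "s+2*t+1 = p \<or> s = p"
      using fwdD(2)[OF f, of s] that(4,5) p' by (auto split: if_splits)
    then show False
    proof
      assume s: "s+2*t+1 = p"
      consider "t < t'" | "t' < t" using \<open>t \<noteq> t'\<close> by linarith
      then show False
        by cases (use s p' fwdD(2)[OF f, of p] fwdD(2)[OF f', of p] fwdD(2)[OF f, of p'] fwdD(2)[OF f', of p'] in auto)
    next
      assume s: "s = p"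
      consider "2*t+1 < 2*t'" | "2*t' < 2*t+1" by atomize_elim presburger
      then show False
      proof cases
        case 1
        then show False
          using s p' fwdD(2)[OF f, of "p+2*t+2"] fwdD(2)[OF f', of "p+2*t+2"] by auto
      next
        case 2
        then show False
          using s p' fwdD(2)[OF f, of "p'"] fwdD(2)[OF f', of "p'"] by (auto split: if_splits)
      qed
    qed
  qed
  consider "p + 2*t' \<le> p' + 2*t" | "p' + 2*t \<le> p + 2*t'" by linarith
  then show False
    by cases (use main[OF f f'] main[OF f' f] assms in auto)
qed

section \<open>Counting the types that cross a cut\<close>

definition fcross :: "nat \<Rightarrow> (label \<times> label) list \<Rightarrow> nat \<Rightarrow> nat \<Rightarrow> bool" where
  "fcross t D a b \<longleftrightarrow> (\<exists>p. fwd D p t \<and> a \<le> p+2*t+2 \<and> p < b+2*t+1)"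

text \<open>Types with an occurrence not contained in one of the two pieces left and right of the
  positions \<open>a..<b\<close> (a cut point if \<open>a = b\<close>).\<close>

definition crossing :: "(label \<times> label) list \<Rightarrow> nat \<Rightarrow> nat \<Rightarrow> nat set" where
  "crossing D a b = {t. fcross t D a b \<or> fcross t (opp D) (length D - b) (length D - a)}"

lemma card_fcross:
  assumes "a \<le> b"
  shows "finite {t. fcross t D a b}" "card {t. fcross t D a b} \<le> b - a + 1"
proof -
  define P where "P t = (SOME p. fwd D p t \<and> a \<le> p+2*t+2 \<and> p < b+2*t+1)" for t
  \<comment> \<open>The start of the chosen occurrence, moved up to \<open>a - 1\<close> if it lies
    before that. This position belongs to the occurrence without its final letter, so
    \<open>fwd_disjoint\<close> makes \<open>h\<close> injective into
    \<open>{a - 1..<b}\<close>.\<close>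
  define h where "h t = max (P t - (2*t+1)) (a - 1)" for t
  have P: "fwd D (P t) t \<and> a \<le> P t+2*t+2 \<and> P t < b+2*t+1" if "fcross t D a b" for t
    using that unfolding fcross_def P_def by (rule someI_ex)
  have img: "h ` {t. fcross t D a b} \<subseteq> {a - 1..<b}"
  proof (rule image_subsetI)
    fix t assume "t \<in> {t. fcross t D a b}"
    with P[of t] fwd_bounds[of D "P t" t] assms show "h t \<in> {a - 1..<b}" by (auto simp: h_def)
  qed
  have inj: "inj_on h {t. fcross t D a b}"
  proof (rule inj_onI, rule ccontr)
    fix t t' assume t: "t \<in> {t. fcross t D a b}" "t' \<in> {t. fcross t D a b}"
      and h: "h t = h t'" and "t \<noteq> t'"
    note pt = P[of t] P[of t'] fwd_bounds[of D "P t" t] fwd_bounds[of D "P t'" t']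
    show False
    proof (rule fwd_disjoint[of D "P t" t "P t'" t' "h t"])
      show "P t \<le> h t + 2*t + 1" "h t < P t + 2*t + 2" using pt t by (auto simp: h_def)
      show "P t' \<le> h t + 2*t' + 1" "h t < P t' + 2*t' + 2"
        unfolding h using pt t by (auto simp: h_def)
    qed (use pt t \<open>t \<noteq> t'\<close> in auto)
  qed
  show "finite {t. fcross t D a b}" using finite_imageD[OF finite_subset[OF img] inj] by simp
  have "card {t. fcross t D a b} \<le> card {a - 1..<b}"
    using card_inj_on_le[OF inj img] by simp
  then show "card {t. fcross t D a b} \<le> b - a + 1" by simp
qed

lemma card_crossing:
  assumes "a \<le> b" "b \<le> length D"
  shows "finite (crossing D a b)" "card (crossing D a b) \<le> 2 * (b - a + 1)"
proof -
  have "length D - b \<le> length D - a" using assms by simp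
  note c = card_fcross[OF assms(1), of D] card_fcross[OF this, of "opp D"]
  have eq: "crossing D a b = {t. fcross t D a b} \<union> {t. fcross t (opp D) (length D - b) (length D - a)}"
    by (auto simp: crossing_def)
  show "finite (crossing D a b)" using c eq by simp
  have "card (crossing D a b) \<le> (b - a + 1) + (length D - a - (length D - b) + 1)"
    unfolding eq by (rule order_trans[OF card_Un_le add_mono[OF c(2) c(4)]])
  then show "card (crossing D a b) \<le> 2 * (b - a + 1)" using assms by simp
qed

section \<open>Occurrences in concatenations and reversals\<close>

lemma fwd_append_left: "fwd P p t \<Longrightarrow> fwd (P @ R) p t"
  by (auto simp: fwd_def nth_append)

lemma fwd_append_leftD: "fwd (P @ R) p t \<Longrightarrow> p+2*t+2 < length P \<Longrightarrow> fwd P p t"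
  by (auto simp: fwd_def nth_append)

lemma fwd_append_right:
  assumes "fwd Q p t" shows "fwd (R @ Q) (length R + p) t"
  unfolding fwd_def
proof (intro conjI allI impI)
  show "2*t+1 \<le> length R + p" "length R + p + 2*t+2 < length (R @ Q)"
    using fwd_bounds[OF assms] by auto
  fix q assume "length R + p \<le> q+2*t+1" "q \<le> length R + p + 2*t+2"
  moreover from this obtain r where "q = length R + r"
    using fwd_bounds[OF assms] le_Suc_ex[of "length R" q] by auto
  ultimately show "fst ((R @ Q) ! q) = (if q+2*t+1 = length R + p \<or> q = length R + p \<or> q = length R + p+2*t+2 then La else Lb)"
    using fwdD(2)[OF assms, of r] by (auto simp: nth_append)
qed

lemma fwd_append_rightD:
  assumes "fwd (R @ Q) (length R + p) t" "2*t+1 \<le> p" shows "fwd Q p t"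
  unfolding fwd_def
proof (intro conjI allI impI)
  show "p + 2*t+2 < length Q" using fwd_bounds[OF assms(1)] by auto
  fix q assume "p \<le> q+2*t+1" "q \<le> p + 2*t+2"
  then show "fst (Q ! q) = (if q+2*t+1 = p \<or> q = p \<or> q = p+2*t+2 then La else Lb)"
    using fwdD(2)[OF assms(1), of "length R + q"] by (auto simp: nth_append)
qed (use assms in auto)

lemma bwd_append_left:
  assumes "bwd P p t" shows "bwd (P @ R) p t"
proof -
  have "length (P @ R) - 1 - p = length (opp R) + (length P - 1 - p)" and p: "p < length P"
    and "fwd (opp P) (length P - 1 - p) t"
    using assms by (auto simp: bwd_def)
  with fwd_append_right[of "opp P" _ t "opp R"]
  have "fwd (opp (P @ R)) (length (P @ R) - 1 - p) t" by (simp only: opp_append)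
  with p show ?thesis unfolding bwd_def by simp
qed

lemma bwd_append_leftD:
  assumes "bwd (P @ R) p t" "p+2*t+1 < length P" shows "bwd P p t"
proof -
  have l: "length (P @ R) - 1 - p = length (opp R) + (length P - 1 - p)" and p: "p < length P"
    and "fwd (opp R @ opp P) (length (P @ R) - 1 - p) t"
    using assms by (auto simp: bwd_def)
  with assms fwd_append_rightD[of "opp R" "opp P" "length P - 1 - p" t]
  have "fwd (opp P) (length P - 1 - p) t" by (simp only: l)
  with p show ?thesis unfolding bwd_def by simp
qed

lemma bwd_bounds:
  assumes "bwd D p t" shows "2*t+2 \<le> p" "p+2*t+1 < length D"
  using assms fwd_bounds[of "opp D" "length D - 1 - p" t] by (auto simp: bwd_def)

lemma crossingI_fwd:
  "fwd D p t \<Longrightarrow> a \<le> p+2*t+2 \<Longrightarrow> p < b+2*t+1 \<Longrightarrow> t \<in> crossing D a b"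
  by (auto simp: crossing_def fcross_def)

lemma crossingI_bwd:
  assumes "bwd D p t" "a \<le> p+2*t+1" "p < b+2*t+2" "a \<le> length D" "b \<le> length D"
  shows "t \<in> crossing D a b"
proof -
  let ?p = "length D - 1 - p"
  have "fwd (opp D) ?p t" using assms by (auto simp: bwd_def)
  moreover have "length D - b \<le> ?p+2*t+2" "?p < length D - a + 2*t+1"
    using assms bwd_bounds[OF assms(1)] by auto
  ultimately show ?thesis unfolding crossing_def fcross_def by blast
qed

lemma bwd_opp: "p < length D \<Longrightarrow> bwd (opp D) (length D - 1 - p) t \<longleftrightarrow> fwd D p t"
  by (auto simp: bwd_def)

lemma fwd_opp: "p < length D \<Longrightarrow> fwd (opp D) (length D - 1 - p) t \<longleftrightarrow> bwd D p t"
  by (auto simp: bwd_def)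

lemma crossing_opp:
  assumes "a \<le> length D" "b \<le> length D"
  shows "crossing (opp D) (length D - b) (length D - a) = crossing D a b"
  using assms by (auto simp: crossing_def)

section \<open>Marks and the value of a word in a group\<close>

definition mark :: "('h, 'c) monoid_scheme \<Rightarrow> (nat \<Rightarrow> 'h) \<Rightarrow> (label \<times> label) list \<Rightarrow> nat \<Rightarrow> 'h" where
  "mark H \<Lambda> D p =
     (if \<exists>t. fwd D p t then \<Lambda> (THE t. fwd D p t)
      else if \<exists>t. bwd D p t then inv\<^bsub>H\<^esub> \<Lambda> (THE t. bwd D p t)
      else \<one>\<^bsub>H\<^esub>)"

lemma mark_fwd: "fwd D p t \<Longrightarrow> mark H \<Lambda> D p = \<Lambda> t"
proof -
  assume f: "fwd D p t"
  then have "(THE t. fwd D p t) = t" by (rule the_equality) (rule fwd_unique[OF _ f])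
  with f show ?thesis unfolding mark_def by auto
qed

text \<open>A forward occurrence with the same middle would take precedence in \<open>mark\<close>;
  coherence excludes it by \<open>fwd_not_bwd\<close>.\<close>

lemma mark_bwd: "coherent (set D) \<Longrightarrow> bwd D p t \<Longrightarrow> mark H \<Lambda> D p = inv\<^bsub>H\<^esub> \<Lambda> t"
proof -
  assume c: "coherent (set D)" and b: "bwd D p t"
  then have "(THE t. bwd D p t) = t" using bwd_unique by blast
  moreover have "\<not> (\<exists>t. fwd D p t)" using fwd_not_bwd[OF c _ b] by blast
  ultimately show ?thesis using b unfolding mark_def by auto
qed

lemma mark_none: "(\<And>t. \<not> fwd D p t) \<Longrightarrow> (\<And>t. \<not> bwd D p t) \<Longrightarrow> mark H \<Lambda> D p = \<one>\<^bsub>H\<^esub>"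
  unfolding mark_def by auto

definition lprod :: "('h, 'c) monoid_scheme \<Rightarrow> 'h list \<Rightarrow> 'h" where
  "lprod H xs = foldr (\<lambda>x y. x \<otimes>\<^bsub>H\<^esub> y) xs \<one>\<^bsub>H\<^esub>"

definition val :: "('h, 'c) monoid_scheme \<Rightarrow> (nat \<Rightarrow> 'h) \<Rightarrow> (label \<times> label) list \<Rightarrow> 'h" where
  "val H \<Lambda> D = lprod H (map (mark H \<Lambda> D) [0..<length D])"

context group
begin

lemma lprod_simps [simp]: "lprod G [] = \<one>" "lprod G (x # xs) = x \<otimes> lprod G xs"
  by (auto simp: lprod_def)

lemma lprod_closed [simp]: "set xs \<subseteq> carrier G \<Longrightarrow> lprod G xs \<in> carrier G"
  by (induction xs) auto

lemma lprod_append [simp]: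
  "set xs \<subseteq> carrier G \<Longrightarrow> set ys \<subseteq> carrier G \<Longrightarrow> lprod G (xs @ ys) = lprod G xs \<otimes> lprod G ys"
  by (induction xs) (auto simp: m_assoc)

lemma lprod_inv:
  "set xs \<subseteq> carrier G \<Longrightarrow> lprod G (rev (map (\<lambda>x. inv x) xs)) = inv (lprod G xs)"
proof (induction xs)
  case (Cons x xs)
  then have "set (rev (map (\<lambda>x. inv x) xs)) \<subseteq> carrier G" by auto
  with Cons show ?case by (simp add: inv_mult_group)
qed simp

lemma lprod_one: "set xs \<subseteq> {\<one>} \<Longrightarrow> lprod G xs = \<one>"
  by (induction xs) auto

context
  fixes \<Lambda> :: "nat \<Rightarrow> 'a"
  assumes \<Lambda>: "\<And>t. \<Lambda> t \<in> carrier G"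
begin

lemma mark_closed [simp]: "mark G \<Lambda> D p \<in> carrier G"
  by (auto simp: mark_def \<Lambda>)

lemma val_closed [simp]: "val G \<Lambda> D \<in> carrier G"
  unfolding val_def by (rule lprod_closed) auto

lemma mark_opp:
  assumes "coherent (set D)" "p < length D"
  shows "mark G \<Lambda> (opp D) (length D - 1 - p) = inv (mark G \<Lambda> D p)"
proof -
  consider t where "fwd D p t" | t where "bwd D p t" | "\<And>t. \<not> fwd D p t" "\<And>t. \<not> bwd D p t"
    by blast
  then show ?thesis
  proof cases
    case 1
    with assms have "bwd (opp D) (length D - 1 - p) t" using bwd_opp by blast
    then show ?thesis using assms by (simp add: mark_bwd mark_fwd[OF 1])
  next
    case 2
    with assms have "fwd (opp D) (length D - 1 - p) t" using fwd_opp by blast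
    then show ?thesis using assms \<Lambda> by (simp add: mark_fwd mark_bwd[OF _ 2])
  next
    case 3
    have "mark G \<Lambda> D p = \<one>" by (rule mark_none) (rule 3)+
    moreover have "mark G \<Lambda> (opp D) (length D - 1 - p) = \<one>"
      by (rule mark_none) (use bwd_opp[OF assms(2)] fwd_opp[OF assms(2)] 3 in blast)+
    ultimately show ?thesis by simp
  qed
qed

text \<open>Reversal inverts every mark and reverses the order of the factors, exactly as inversion
  acts on a product.\<close>

lemma val_opp:
  assumes "coherent (set D)"
  shows "val G \<Lambda> (opp D) = inv (val G \<Lambda> D)"
proof -
  have "map (mark G \<Lambda> (opp D)) [0..<length D] = rev (map (\<lambda>x. inv x) (map (mark G \<Lambda> D) [0..<length D]))"
  proof (rule nth_equalityI)
    fix i assume "i < length (map (mark G \<Lambda> (opp D)) [0..<length D])"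
    then show "map (mark G \<Lambda> (opp D)) [0..<length D] ! i =
        rev (map (\<lambda>x. inv x) (map (mark G \<Lambda> D) [0..<length D])) ! i"
      using mark_opp[OF assms, of "length D - 1 - i"] by (simp add: rev_nth)
  qed simp
  then show ?thesis
    unfolding val_def by (simp only: length_opp) (rule lprod_inv, auto)
qed

text \<open>An occurrence inside \<open>P\<close> survives in \<open>P @ R\<close>. An occurrence
  with its middle in \<open>P\<close> that is not inside \<open>P\<close> reaches beyond the end of
  \<open>P\<close>, so its type is crossing and has trivial value.\<close>

lemma mark_prefix:
  assumes c: "coherent (set (P @ R))" and p: "p < length P" and ab: "length P \<le> b" "b \<le> length (P @ R)"
    and tr: "\<And>t. t \<in> crossing (P @ R) (length P) b \<Longrightarrow> \<Lambda> t = \<one>"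
  shows "mark G \<Lambda> (P @ R) p = mark G \<Lambda> P p"
proof -
  have cP: "coherent (set P)" using coherent_mono[OF c] by auto
  consider t where "fwd P p t" | t where "bwd P p t" | "\<And>t. \<not> fwd P p t" "\<And>t. \<not> bwd P p t"
    by blast
  then show ?thesis
  proof cases
    case 1
    then show ?thesis by (simp add: mark_fwd mark_fwd[OF fwd_append_left])
  next
    case 2
    then show ?thesis using c cP by (simp add: mark_bwd mark_bwd[OF _ bwd_append_left])
  next
    case 3
    have "mark G \<Lambda> (P @ R) p = \<one>"
    proof -
      consider t where "fwd (P @ R) p t" | t where "bwd (P @ R) p t"
        | "\<And>t. \<not> fwd (P @ R) p t" "\<And>t. \<not> bwd (P @ R) p t" by blast
      then show ?thesis
      proof cases
        case (1 t)
        then have "t \<in> crossing (P @ R) (length P) b"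
          by (rule crossingI_fwd) (use 3(1)[of t] p ab fwd_append_leftD[OF 1] in linarith)+
        then show ?thesis using mark_fwd[OF 1, of G \<Lambda>] tr[of t] by simp
      next
        case (2 t)
        then have "t \<in> crossing (P @ R) (length P) b"
          by (rule crossingI_bwd) (use 3(2)[of t] p ab bwd_append_leftD[OF 2] in \<open>linarith | simp\<close>)+
        then show ?thesis using mark_bwd[OF c 2, of G \<Lambda>] tr[of t] by simp
      qed (rule mark_none)
    qed
    moreover have "mark G \<Lambda> P p = \<one>" by (rule mark_none) (rule 3)+
    ultimately show ?thesis by simp
  qed
qed

text \<open>Obtained from \<open>mark_prefix\<close> by passing to \<open>opp\<close>, which inverts
  marks, and cancelling the inverse.\<close>

lemma mark_suffix:
  assumes c: "coherent (set (R @ Q))" and p: "p < length Q" and a: "a \<le> length R"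
    and tr: "\<And>t. t \<in> crossing (R @ Q) a (length R) \<Longrightarrow> \<Lambda> t = \<one>"
  shows "mark G \<Lambda> (R @ Q) (length R + p) = mark G \<Lambda> Q p"
proof -
  let ?p = "length Q - 1 - p"
  have cQ: "coherent (set Q)" using coherent_mono[OF c] by auto
  have "mark G \<Lambda> (opp Q @ opp R) ?p = mark G \<Lambda> (opp Q) ?p"
  proof (rule mark_prefix[where b = "length (R @ Q) - a"])
    show "coherent (set (opp Q @ opp R))" using c coherent_opp[of "R @ Q"] by simp
    fix t assume "t \<in> crossing (opp Q @ opp R) (length (opp Q)) (length (R @ Q) - a)"
    then show "\<Lambda> t = \<one>"
      using tr[of t] crossing_opp[of a "R @ Q" "length R"] a by simp
  qed (use p a in auto)
  moreover have "mark G \<Lambda> (opp Q) ?p = inv (mark G \<Lambda> Q p)"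
    by (rule mark_opp[OF cQ p])
  moreover have "mark G \<Lambda> (opp (R @ Q)) (length (R @ Q) - 1 - (length R + p)) = inv (mark G \<Lambda> (R @ Q) (length R + p))"
    by (rule mark_opp[OF c]) (use p in simp)
  moreover have "length (R @ Q) - 1 - (length R + p) = ?p" by simp
  ultimately have "inv (mark G \<Lambda> (R @ Q) (length R + p)) = inv (mark G \<Lambda> Q p)"
    by simp
  then have "inv (inv (mark G \<Lambda> (R @ Q) (length R + p))) = inv (inv (mark G \<Lambda> Q p))"
    by (rule arg_cong)
  then show ?thesis by simp
qed

lemma mark_middle:
  assumes c: "coherent (set D)" and ab: "a \<le> p" "p < b" "b \<le> length D"
    and tr: "\<And>t. t \<in> crossing D a b \<Longrightarrow> \<Lambda> t = \<one>"
  shows "mark G \<Lambda> D p = \<one>"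
proof -
  consider t where "fwd D p t" | t where "bwd D p t" | "\<And>t. \<not> fwd D p t" "\<And>t. \<not> bwd D p t"
    by blast
  then show ?thesis
  proof cases
    case 1
    then show ?thesis using tr[OF crossingI_fwd[OF 1]] ab by (simp add: mark_fwd)
  next
    case 2
    then show ?thesis using tr[OF crossingI_bwd[OF 2]] ab c by (simp add: mark_bwd)
  qed (rule mark_none)
qed

text \<open>Once the crossing types have trivial value, the marks over \<open>P\<close> and
  \<open>Q\<close> are those of the separate pieces, and every mark over \<open>X\<close> is
  trivial. This is what makes values multiplicative.\<close>

lemma val_split:
  assumes c: "coherent (set (P @ X @ Q))"
    and tr: "\<And>t. t \<in> crossing (P @ X @ Q) (length P) (length P + length X) \<Longrightarrow> \<Lambda> t = \<one>"
  shows "val G \<Lambda> (P @ X @ Q) = val G \<Lambda> P \<otimes> val G \<Lambda> Q"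
proof -
  let ?D = "P @ X @ Q" and ?a = "length P" and ?b = "length P + length X"
  have split: "[0..<length ?D] = [0..<?a] @ [?a..<?b] @ map (\<lambda>i. i + ?b) [0..<length Q]"
  proof -
    have "[0..<length ?D] = [0..<?b] @ [?b..<?b + length Q]"
      using upt_add_eq_append[of 0 ?b "length Q"] by (simp add: add.assoc)
    moreover have "[0..<?b] = [0..<?a] @ [?a..<?b]"
      using upt_add_eq_append[of 0 ?a "length X"] by simp
    moreover have "[?b..<?b + length Q] = map (\<lambda>i. i + ?b) [0..<length Q]"
      by (simp add: map_add_upt add.commute)
    ultimately show ?thesis by simp
  qed
  have 1: "map (mark G \<Lambda> ?D) [0..<?a] = map (mark G \<Lambda> P) [0..<?a]"
    by (rule map_cong[OF refl], rule mark_prefix[where b = ?b]) (use c tr in auto)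
  have 2: "lprod G (map (mark G \<Lambda> ?D) [?a..<?b]) = \<one>"
    by (rule lprod_one) (use c tr mark_middle[where a = ?a and b = ?b and D = ?D] in auto)
  have 3: "map (\<lambda>i. mark G \<Lambda> ?D (i + ?b)) [0..<length Q] = map (mark G \<Lambda> Q) [0..<length Q]"
    using mark_suffix[of "P @ X" Q _ ?a] c tr by (auto simp: add.commute)
  have cl: "set (map f xs) \<subseteq> carrier G" if "\<And>i. f i \<in> carrier G" for f :: "nat \<Rightarrow> 'a" and xs
    using that by auto
  have "val G \<Lambda> ?D = lprod G (map (mark G \<Lambda> ?D) [0..<?a] @ map (mark G \<Lambda> ?D) [?a..<?b]
      @ map (\<lambda>i. mark G \<Lambda> ?D (i + ?b)) [0..<length Q])"
    unfolding val_def split map_append map_map o_def ..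
  also have "\<dots> = lprod G (map (mark G \<Lambda> P) [0..<?a]) \<otimes>
      (lprod G (map (mark G \<Lambda> ?D) [?a..<?b]) \<otimes> lprod G (map (mark G \<Lambda> Q) [0..<length Q]))"
    unfolding 1 3 by (simp add: cl del: set_map)
  finally have "val G \<Lambda> ?D = val G \<Lambda> P \<otimes> (\<one> \<otimes> val G \<Lambda> Q)"
    unfolding 2 val_def .
  then show ?thesis by simp
qed

end

end

section \<open>Marks on the words $u_{\bar e}$\<close>

lemma u_word_Nil: "u_word [] = [La]"
  by (simp add: u_word_def)

lemma u_word_Cons: "u_word (e # es) = La # replicate e Lb @ u_word es"
  by (simp add: u_word_def)

lemma u_word_append: "u_word (es @ e # es') = u_word es @ replicate e Lb @ u_word es'"
  by (induction es) (simp_all add: u_word_Nil u_word_Cons)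

lemma u_word_snoc: "\<exists>A. u_word es = A @ [La]"
  by (induction es) (auto simp: u_word_Nil u_word_Cons)

lemma u_word_hd: "\<exists>A. u_word es = La # A"
  by (cases es) (auto simp: u_word_Nil u_word_Cons)

lemma set_u_word: "set (u_word es) \<subseteq> {La, Lb}"
  by (induction es) (auto simp: u_word_Nil u_word_Cons)

lemma length_u_word_ge: "e \<in> set es \<Longrightarrow> e < length (u_word es)"
  by (induction es) (auto simp: u_word_Nil u_word_Cons)

text \<open>Recovers an exponent from its position in the word. The induction distinguishes a start
  at the first letter, a start inside the first block, where the letter would be \<open>Lb\<close>,
  and a start beyond it.\<close>

lemma u_word_block:
  assumes "s + m + 1 < length (u_word es)" "u_word es ! s = La" "u_word es ! (s + m + 1) = La"
    and "\<And>q. s < q \<Longrightarrow> q < s + m + 1 \<Longrightarrow> u_word es ! q = Lb"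
  shows "\<exists>es1 es2. es = es1 @ m # es2 \<and> length (u_word es1) = s + 1"
  using assms
proof (induction es arbitrary: s)
  case Nil
  then show ?case by (simp add: u_word_Nil)
next
  case (Cons e es)
  obtain A where A: "u_word es = La # A" using u_word_hd by blast
  have nth: "u_word (e # es) ! q = (if q = 0 then La else if q < e + 1 then Lb else u_word es ! (q - (e + 1)))"
    for q by (cases q) (auto simp: u_word_Cons nth_append)
  consider "s = 0" | "0 < s" "s < e + 1" | r where "s = e + 1 + r"
    by (metis le_Suc_ex not_gr_zero not_less)
  then show ?case
  proof cases
    case 1
    have "\<not> m < e" using Cons.prems(3) 1 by (auto simp: nth split: if_splits)
    moreover have "\<not> e < m" using Cons.prems(4)[of "e + 1"] 1 A by (auto simp: nth)
    ultimately have "m = e" by simp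
    with 1 show ?thesis by (intro exI[of _ "[]"] exI[of _ es]) (simp add: u_word_Nil)
  next
    case 2
    then show ?thesis using Cons.prems(2) by (simp add: nth)
  next
    case (3 r)
    have "u_word es ! q = Lb" if "r < q" "q < r + m + 1" for q
      using Cons.prems(4)[of "e + 1 + q"] that 3 by (simp add: nth)
    moreover have "r + m + 1 < length (u_word es)" "u_word es ! r = La" "u_word es ! (r + m + 1) = La"
      using Cons.prems(1) Cons.prems(2,3)[unfolded nth] 3 by (simp_all add: u_word_Cons)
    ultimately obtain es1 es2 where "es = es1 @ m # es2" "length (u_word es1) = r + 1"
      using Cons.IH by blast
    then show ?thesis
      by (intro exI[of _ "e # es1"] exI[of _ es2]) (simp add: u_word_Cons 3)
  qed
qed

lemma fwd_u_wordD:
  assumes "map fst D = u_word es" "fwd D p t"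
  shows "\<exists>es1 es2. es = es1 @ (2*t) # es2 \<and> length (u_word es1) + 2*t = p"
proof -
  have nth: "u_word es ! q = fst (D ! q)" if "q < length D" for q
    using assms(1) that by (metis nth_map)
  have len: "length (u_word es) = length D" using assms(1) by (metis length_map)
  obtain s where s: "p = s + 2*t + 1"
    using fwd_bounds(1)[OF assms(2)] le_Suc_ex by (metis add.assoc add.commute)
  have "\<exists>es1 es2. es = es1 @ (2*t) # es2 \<and> length (u_word es1) = s + 1"
    by (rule u_word_block) (use s len nth fwdD[OF assms(2)] in auto)
  then show ?thesis using s by auto
qed

text \<open>The first labels are only \<open>La\<close> and \<open>Lb\<close>. Under the first
  alternative of coherence the two labels of each letter of the occurrence therefore agree, and the
  word contains the reversed pattern, with exponent \<open>2*t+1\<close> before \<open>2*t\<close>.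
  The second alternative produces the exponent 0.\<close>

lemma bwd_u_wordD:
  assumes "map fst D = u_word es" "coherent (set D)" "bwd D p t" "t \<noteq> 0"
  shows "0 \<in> set es \<or>
    (\<exists>es1 es2 es3 es4. es = es1 @ (2*t+1) # es2 \<and> es = es3 @ (2*t) # es4 \<and>
       length (u_word es1) < length (u_word es3))"
proof -
  have nth: "u_word es ! q = fst (D ! q)" if "q < length D" for q
    using assms(1) that by (metis nth_map)
  have len: "length (u_word es) = length D" using assms(1) by (metis length_map)
  have ab: "fst (D ! q) = La \<or> fst (D ! q) = Lb" if "q < length D" for q
    using set_u_word[of es] nth[OF that] nth_mem[of q "u_word es"] that len by auto
  note bD = bwdD[OF assms(3)]
  obtain s where s: "p = s + 2*t + 2"
    using bwd_bounds(1)[OF assms(3)] le_Suc_ex by (metis add.assoc add.commute)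
  have b: "p + 2*t + 1 < length D" using bwd_bounds(2)[OF assms(3)] .
  consider "(La, Lb) \<notin> set D" "(Lb, La) \<notin> set D"
    | "\<And>x. x \<in> set D \<Longrightarrow> snd x = Lb \<longleftrightarrow> fst x = La"
    using assms(2) unfolding coherent_def by metis
  then show ?thesis
  proof cases
    case 1
    have eq: "fst (D ! q) = snd (D ! q)" if "q < length D" "snd (D ! q) \<in> {La, Lb}" for q
      using ab[OF that(1)] that(2) 1 nth_mem[OF that(1)] by (cases "D ! q") auto
    have F: "u_word es ! q = (if q+2*t+2 = p \<or> q = p \<or> q = p+2*t+1 then La else Lb)"
      if "p \<le> q+2*t+2" "q \<le> p+2*t+1" for q
      using bD[OF that] eq[of q] nth[of q] by auto
    have 1: "\<exists>es1 es2. es = es1 @ (2*t+1) # es2 \<and> length (u_word es1) = s + 1"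
      by (rule u_word_block) (use s b len F in auto)
    have 2: "\<exists>es1 es2. es = es1 @ (2*t) # es2 \<and> length (u_word es1) = p + 1"
      by (rule u_word_block) (use s b len F in auto)
    have "s + 1 < p + 1" using s by simp
    with 1 2 show ?thesis by metis
  next
    case 2
    \<comment> \<open>Since \<open>t\<close> is not 0, the last two letters before \<open>p\<close>
      lie in the long block. Their second labels are \<open>Lb\<close>, so their first labels are
      two adjacent \<open>La\<close>.\<close>
    define r where "r = s + 2*t"
    have r: "p = r + 2" "r \<ge> 1" using s assms(4) by (auto simp: r_def)
    have "snd (D ! r) = Lb" "snd (D ! (r + 1)) = Lb"
      using bD[of r] bD[of "r+1"] r s assms(4) by (auto split: if_splits)
    then have "fst (D ! r) = La" "fst (D ! (r + 1)) = La"
      using 2[OF nth_mem] b r by auto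
    then have "\<exists>es1 es2. es = es1 @ 0 # es2 \<and> length (u_word es1) = r + 1"
      by (intro u_word_block) (use b r len nth in auto)
    then show ?thesis by auto
  qed
qed

lemma u_word_prefix_less:
  assumes "es = es1 @ x # es2" "es = es3 @ y # es4" "length (u_word es1) < length (u_word es3)"
    and "sorted_wrt (<) es"
  shows "x < (y::nat)"
proof -
  have "length es1 < length es3"
  proof (rule ccontr)
    assume "\<not> length es1 < length es3"
    with assms(1,2) obtain zs where "es1 = es3 @ zs"
      by (metis append_eq_append_conv_if append_take_drop_id not_less)
    then have "length (u_word es3) \<le> length (u_word es1)"
      by (cases zs) (auto simp: u_word_append)
    with assms(3) show False by simp
  qed
  moreover have "es ! length es1 = x" "es ! length es3 = y" "length es3 < length es"
    using assms(1) apply simp using assms(2) by simp_all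
  ultimately show ?thesis using sorted_wrt_nth_less[OF assms(4)] by metis
qed

lemma fwd_u_wordI:
  assumes "map fst D = u_word (es1 @ [2*t, 2*t+1] @ es2)"
  shows "fwd D (length (u_word es1) + 2*t) t"
proof -
  obtain A where A: "u_word es1 = A @ [La]" using u_word_snoc by blast
  obtain B where B: "u_word es2 = La # B" using u_word_hd by blast
  have eq: "map fst D = A @ [La] @ replicate (2*t) Lb @ [La] @ replicate (2*t+1) Lb @ [La] @ B"
    using assms by (simp add: u_word_append u_word_Cons A B del: replicate.simps)
  have "length (map fst D) = length A + 4*t + 4 + length B" unfolding eq by simp
  then have len: "length D = length A + 4*t + 4 + length B" by simp
  show ?thesis
    unfolding fwd_def
  proof (intro conjI allI impI)
    fix q assume q: "length (u_word es1) + 2*t \<le> q+2*t+1" "q \<le> length (u_word es1) + 2*t+2*t+2"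
    then have "q < length D" using len A by simp
    then have "fst (D ! q) = map fst D ! q" by simp
    moreover obtain r where "q = length A + r" using q A le_Suc_ex[of "length A" q] by auto
    ultimately show "fst (D ! q) = (if q+2*t+1 = length (u_word es1) + 2*t \<or> q = length (u_word es1) + 2*t \<or> q = length (u_word es1) + 2*t+2*t+2 then La else Lb)"
      using q A unfolding eq by (auto simp: nth_append nth_Cons split: nat.splits)
  qed (use len A in auto)
qed

text \<open>An occurrence of type \<open>t\<close> is longer than \<open>t\<close>, so only types
  below \<open>length D\<close> can occur in \<open>D\<close>. Values chosen later for larger types
  do not disturb \<open>D\<close>.\<close>

lemma val_cong:
  assumes "\<And>t. t < length D \<Longrightarrow> \<Lambda> t = \<Lambda>' t"
  shows "val H \<Lambda> D = val H \<Lambda>' D"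
proof -
  have "mark H \<Lambda> D p = mark H \<Lambda>' D p" if "p < length D" for p
  proof (cases "\<exists>t. fwd D p t")
    case True
    then obtain t where t: "fwd D p t" by blast
    then have "t < length D" using fwd_bounds[of D p t] by simp
    with t assms show ?thesis by (simp add: mark_fwd)
  next
    case F: False
    show ?thesis
    proof (cases "\<exists>t. bwd D p t")
      case True
      then obtain t where t: "bwd D p t" by blast
      then have "t < length D" using bwd_bounds[of D p t] by simp
      moreover have "(THE t. bwd D p t) = t" using t bwd_unique by blast
      ultimately show ?thesis using assms F by (auto simp: mark_def)
    qed (use F in \<open>auto simp: mark_def\<close>)
  qed
  then show ?thesis by (auto simp: val_def intro: arg_cong[where f = "lprod H"])
qed

lemma (in group) lprod_single:
  assumes "p < length xs" "xs ! p \<in> carrier G" "\<And>q. q < length xs \<Longrightarrow> q \<noteq> p \<Longrightarrow> xs ! q = \<one>"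
  shows "lprod G xs = xs ! p"
proof -
  have eq: "xs = take p xs @ xs ! p # drop (Suc p) xs" using assms(1) by (simp add: id_take_nth_drop)
  have 1: "set (take p xs) \<subseteq> {\<one>}" "set (drop (Suc p) xs) \<subseteq> {\<one>}"
    using assms(3) by (auto simp: in_set_conv_nth)
  then have 2: "set (take p xs) \<subseteq> carrier G" "set (xs ! p # drop (Suc p) xs) \<subseteq> carrier G"
    using assms(2) by auto
  have "lprod G xs = lprod G (take p xs) \<otimes> lprod G (xs ! p # drop (Suc p) xs)"
    by (subst eq) (rule lprod_append[OF 2])
  then show ?thesis using assms(2) by (simp add: lprod_one[OF 1(1)] lprod_one[OF 1(2)])
qed

text \<open>The exponents increase strictly, so each type from \<open>c\<close> to
  \<open>c + M - 1\<close> has exactly one forward occurrence, and a backward occurrence can only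
  have type 0. Hence a single mark survives.\<close>

lemma (in group) val_u_word:
  assumes \<Lambda>: "\<And>t. \<Lambda> t \<in> carrier G" and c: "coherent (set D)" "0 < c"
    and D: "map fst D = u_word [2*c..<2*c+2*M]"
    and t: "c \<le> t" "t < c + M"
    and other: "\<And>t'. c \<le> t' \<Longrightarrow> t' < c + M \<Longrightarrow> t' \<noteq> t \<Longrightarrow> \<Lambda> t' = \<one>" and "\<Lambda> 0 = \<one>"
  shows "val G \<Lambda> D = \<Lambda> t"
proof -
  let ?es = "[2*c..<2*c+2*M]" and ?es1 = "[2*c..<2*t]" and ?es2 = "[2*t+2..<2*c+2*M]"
  let ?p = "length (u_word ?es1) + 2*t"
  have "?es = ?es1 @ [2*t..<2*c+2*M]"
    using upt_add_eq_append[of "2*c" "2*t" "2*c+2*M-2*t"] t by simp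
  also have "[2*t..<2*c+2*M] = [2*t, 2*t+1] @ ?es2"
    using t by (simp add: upt_conv_Cons)
  finally have es: "?es = ?es1 @ [2*t, 2*t+1] @ ?es2" .
  have f: "fwd D ?p t" by (rule fwd_u_wordI) (use D es in simp)
  have m: "mark G \<Lambda> D q = \<one>" if "q \<noteq> ?p" for q
  proof -
    consider t' where "fwd D q t'" | t' where "bwd D q t'" | "\<And>t. \<not> fwd D q t" "\<And>t. \<not> bwd D q t"
      by blast
    then show ?thesis
    proof cases
      case (1 t')
      from fwd_u_wordD[OF D 1] obtain fs1 fs2 where
        fs: "?es = fs1 @ (2*t') # fs2" "length (u_word fs1) + 2*t' = q" by blast
      have "2*t' \<in> set ?es" unfolding fs(1) by simp
      then have r: "c \<le> t'" "t' < c + M" by auto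
      have "t' \<noteq> t"
      proof
        assume "t' = t"
        \<comment> \<open>The exponents are distinct, so the part before \<open>2*t\<close> is the
          same in both decompositions; this fixes the position of the occurrence.\<close>
        then have "takeWhile (\<lambda>e. e \<noteq> 2*t) (fs1 @ (2*t) # fs2) = takeWhile (\<lambda>e. e \<noteq> 2*t) (?es1 @ (2*t) # (2*t+1) # ?es2)"
          using fs es by simp
        moreover have "\<forall>e\<in>set fs1. e \<noteq> 2*t"
          using fs(1) \<open>t' = t\<close> distinct_upt[of "2*c" "2*c+2*M"] by auto
        moreover have "\<forall>e\<in>set ?es1. e \<noteq> 2*t" by simp
        ultimately have "fs1 = ?es1" by (simp add: takeWhile_append)
        with fs \<open>t' = t\<close> that show False by simp
      qed
      with other[OF r] show ?thesis by (simp add: mark_fwd[OF 1])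
    next
      case (2 t')
      \<comment> \<open>Any other type would need the exponent 0, or \<open>2*t'+1\<close> before
        \<open>2*t'\<close>, in an increasing sequence of positive numbers.\<close>
      have "t' = 0"
      proof (rule ccontr)
        assume "t' \<noteq> 0"
        have "0 \<notin> set ?es" using c(2) by simp
        with bwd_u_wordD[OF D c(1) 2 \<open>t' \<noteq> 0\<close>] obtain es1 es2 es3 es4 where
          "?es = es1 @ (2*t'+1) # es2" "?es = es3 @ (2*t') # es4"
          "length (u_word es1) < length (u_word es3)" by blast
        then have "2*t'+1 < 2*t'" by (rule u_word_prefix_less) (rule sorted_wrt_upt)
        then show False by simp
      qed
      then show ?thesis using mark_bwd[OF c(1) 2, of G \<Lambda>] \<open>\<Lambda> 0 = \<one>\<close> by simp
    qed (rule mark_none)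
  qed
  have "?p < length D" using fwd_bounds(2)[OF f] by simp
  then have "val G \<Lambda> D = map (mark G \<Lambda> D) [0..<length D] ! ?p"
    unfolding val_def using m mark_closed[OF \<Lambda>] by (intro lprod_single) auto
  also have "\<dots> = \<Lambda> t" using \<open>?p < length D\<close> by (simp add: mark_fwd[OF f])
  finally show ?thesis .
qed

section \<open>Transfer of positive sentences\<close>

text \<open>Here \<open>\<tau> i\<close> is the type reserved for the universal variable
  \<open>i\<close>, and \<open>\<sigma> i\<close> the value played for it in the target group. The
  default \<open>e\<close> will be the identity, so that unreserved types leave no trace.\<close>

definition spread :: "(nat \<Rightarrow> nat) \<Rightarrow> nat set \<Rightarrow> 'h \<Rightarrow> (nat \<Rightarrow> 'h) \<Rightarrow> nat \<Rightarrow> 'h" where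
  "spread \<tau> U e \<sigma> t = (if t \<in> \<tau> ` U then \<sigma> (inv_into U \<tau> t) else e)"

lemma spread_in: "inj_on \<tau> U \<Longrightarrow> i \<in> U \<Longrightarrow> spread \<tau> U e \<sigma> (\<tau> i) = \<sigma> i"
  by (simp add: spread_def)

lemma spread_notin: "t \<notin> \<tau> ` U \<Longrightarrow> spread \<tau> U e \<sigma> t = e"
  by (simp add: spread_def)

definition universals :: "quant list \<Rightarrow> nat set" where
  "universals qs = {i. i < length qs \<and> qs ! i = QAll}"

text \<open>Axioms for the word \<open>dw g\<close> read along the path from \<open>v\<close> to
  \<open>g v\<close>. In \<open>dw_mult\<close> the words \<open>P\<close>, \<open>Q\<close>,
  \<open>R\<close> belong to the legs of the tripod, and \<open>X\<close>, \<open>Y\<close>,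
  \<open>Z\<close> are read across its centre. The free group and labelled tree actions are both
  instances.\<close>

locale labelled_group = group G for G :: "('g, 'b) monoid_scheme" (structure) +
  fixes dw :: "'g \<Rightarrow> (label \<times> label) list" and K :: nat
  assumes dw_one: "dw \<one> = []"
    and dw_inv: "g \<in> carrier G \<Longrightarrow> dw (inv g) = opp (dw g)"
    and dw_mult: "g \<in> carrier G \<Longrightarrow> h \<in> carrier G \<Longrightarrow>
      \<exists>P X Q Y R Z. dw g = P @ X @ Q \<and> dw h = opp Q @ Y @ R \<and> dw (g \<otimes> h) = P @ Z @ R \<and>
        length X \<le> K \<and> length Y \<le> K \<and> length Z \<le> K"
    and dw_coherent: "coherent (\<Union>g\<in>carrier G. set (dw g))"
    and dw_u_word: "\<forall>e\<in>set es. 0 < e \<Longrightarrow> \<exists>g\<in>carrier G. map fst (dw g) = u_word es"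
begin

lemma coherent_dw: "g \<in> carrier G \<Longrightarrow> coherent (set (dw g))"
  by (rule coherent_mono[OF dw_coherent]) auto

lemma val_dw_inv:
  assumes "group H" "\<And>t. \<Lambda> t \<in> carrier H" "g \<in> carrier G"
  shows "val H \<Lambda> (dw (inv g)) = inv\<^bsub>H\<^esub> val H \<Lambda> (dw g)"
  using group.val_opp[OF assms(1,2) coherent_dw[OF assms(3)]] by (simp add: dw_inv assms(3))

text \<open>Each of the three sides of the tripod has at most \<open>2 * (K + 1)\<close> crossing
  types. If these are trivial, \<open>val_split\<close> applies to all three sides and the two
  factors coming from the leg \<open>Q\<close> cancel.\<close>

lemma val_dw_mult:
  fixes H :: "('h, 'c) monoid_scheme"
  assumes "group H" and g: "g \<in> carrier G" and h: "h \<in> carrier G"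
  shows "\<exists>B. finite B \<and> card B \<le> 6 * (K + 1) \<and>
    (\<forall>\<Lambda>. (\<forall>t. \<Lambda> t \<in> carrier H) \<longrightarrow> (\<forall>t\<in>B. \<Lambda> t = \<one>\<^bsub>H\<^esub>) \<longrightarrow>
       val H \<Lambda> (dw (g \<otimes> h)) = val H \<Lambda> (dw g) \<otimes>\<^bsub>H\<^esub> val H \<Lambda> (dw h))"
proof -
  interpret H: group H by fact
  from dw_mult[OF g h] obtain P X Q Y R Z where
    eq: "dw g = P @ X @ Q" "dw h = opp Q @ Y @ R" "dw (g \<otimes> h) = P @ Z @ R"
    and le: "length X \<le> K" "length Y \<le> K" "length Z \<le> K" by blast
  let ?B1 = "crossing (P @ X @ Q) (length P) (length P + length X)"
  let ?B2 = "crossing (opp Q @ Y @ R) (length (opp Q)) (length (opp Q) + length Y)"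
  let ?B3 = "crossing (P @ Z @ R) (length P) (length P + length Z)"
  have c: "coherent (set (P @ X @ Q))" "coherent (set (opp Q @ Y @ R))" "coherent (set (P @ Z @ R))"
    using coherent_dw[OF g] coherent_dw[OF h] coherent_dw[OF m_closed[OF g h]] unfolding eq by auto
  have B: "finite (crossing (S @ W @ T) (length S) (length S + length W)) \<and>
      card (crossing (S @ W @ T) (length S) (length S + length W)) \<le> 2 * (K + 1)"
    if "length W \<le> K" for S W T
    using card_crossing[of "length S" "length S + length W" "S @ W @ T"] that by auto
  show ?thesis
  proof (rule exI[of _ "?B1 \<union> ?B2 \<union> ?B3"], intro conjI allI impI)
    show "finite (?B1 \<union> ?B2 \<union> ?B3)" using B[OF le(1)] B[OF le(2)] B[OF le(3)] by blast
    have "card (?B1 \<union> ?B2 \<union> ?B3) \<le> card ?B1 + card ?B2 + card ?B3"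
      by (meson add_le_mono1 card_Un_le order_trans)
    also have "\<dots> \<le> 6 * (K + 1)"
      using B[OF le(1), of P Q] B[OF le(2), of "opp Q" R] B[OF le(3), of P R] by linarith
    finally show "card (?B1 \<union> ?B2 \<union> ?B3) \<le> 6 * (K + 1)" .
  next
    fix \<Lambda> assume "\<forall>t. \<Lambda> t \<in> carrier H" and 1: "\<forall>t\<in>?B1 \<union> ?B2 \<union> ?B3. \<Lambda> t = \<one>\<^bsub>H\<^esub>"
    then have \<Lambda>: "\<And>t. \<Lambda> t \<in> carrier H" by blast
    have cQ: "coherent (set Q)" by (rule coherent_mono[OF c(1)]) auto
    note [simp] = H.val_closed[OF \<Lambda>]
    have v: "val H \<Lambda> (dw g) = val H \<Lambda> P \<otimes>\<^bsub>H\<^esub> val H \<Lambda> Q"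
      "val H \<Lambda> (dw h) = inv\<^bsub>H\<^esub> val H \<Lambda> Q \<otimes>\<^bsub>H\<^esub> val H \<Lambda> R"
      "val H \<Lambda> (dw (g \<otimes> h)) = val H \<Lambda> P \<otimes>\<^bsub>H\<^esub> val H \<Lambda> R"
      unfolding eq H.val_opp[OF \<Lambda> cQ, symmetric]
      by (rule H.val_split[OF \<Lambda>]; use c 1 in blast)+
    have "val H \<Lambda> (dw g) \<otimes>\<^bsub>H\<^esub> val H \<Lambda> (dw h) =
        val H \<Lambda> P \<otimes>\<^bsub>H\<^esub> (val H \<Lambda> Q \<otimes>\<^bsub>H\<^esub> inv\<^bsub>H\<^esub> val H \<Lambda> Q) \<otimes>\<^bsub>H\<^esub> val H \<Lambda> R"
      unfolding v by (simp only: H.m_assoc H.m_closed H.inv_closed H.val_closed[OF \<Lambda>])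
    then show "val H \<Lambda> (dw (g \<otimes> h)) = val H \<Lambda> (dw g) \<otimes>\<^bsub>H\<^esub> val H \<Lambda> (dw h)"
      unfolding v(3) by simp
  qed
qed

lemma eval_word_Cons:
  "eval_word M \<rho> (l # w) = (if fst l then inv\<^bsub>M\<^esub> \<rho> (snd l) else \<rho> (snd l)) \<otimes>\<^bsub>M\<^esub> eval_word M \<rho> w"
  by (simp add: eval_word_def)

lemma eval_word_closed: "(\<And>i. \<rho> i \<in> carrier G) \<Longrightarrow> eval_word G \<rho> w \<in> carrier G"
  by (induction w) (auto simp: eval_word_def)

text \<open>One multiplication per letter, so the bad types add up. The set \<open>B\<close> is
  fixed before \<open>\<Lambda>\<close> is chosen, which lets the types of the variables be selected
  outside it.\<close>

lemma val_eval_word: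
  fixes H :: "('h, 'c) monoid_scheme"
  assumes "group H" and \<rho>: "\<And>i. \<rho> i \<in> carrier G"
  shows "\<exists>B. finite B \<and> card B \<le> length w * (6 * (K + 1)) \<and>
    (\<forall>\<Lambda>. (\<forall>t. \<Lambda> t \<in> carrier H) \<longrightarrow> (\<forall>t\<in>B. \<Lambda> t = \<one>\<^bsub>H\<^esub>) \<longrightarrow>
       val H \<Lambda> (dw (eval_word G \<rho> w)) = eval_word H (\<lambda>i. val H \<Lambda> (dw (\<rho> i))) w)"
proof (induction w)
  case Nil
  interpret H: group H by fact
  show ?case by (rule exI[of _ "{}"]) (simp add: eval_word_def dw_one val_def)
next
  case (Cons l w)
  then obtain B where B: "finite B" "card B \<le> length w * (6 * (K + 1))"
    and B': "\<forall>\<Lambda>. (\<forall>t. \<Lambda> t \<in> carrier H) \<longrightarrow> (\<forall>t\<in>B. \<Lambda> t = \<one>\<^bsub>H\<^esub>) \<longrightarrow>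
       val H \<Lambda> (dw (eval_word G \<rho> w)) = eval_word H (\<lambda>i. val H \<Lambda> (dw (\<rho> i))) w"
    by (elim exE conjE)
  let ?g = "if fst l then inv \<rho> (snd l) else \<rho> (snd l)"
  have g: "?g \<in> carrier G" using \<rho> by simp
  obtain C where C: "finite C" "card C \<le> 6 * (K + 1)"
    and C': "\<forall>\<Lambda>. (\<forall>t. \<Lambda> t \<in> carrier H) \<longrightarrow> (\<forall>t\<in>C. \<Lambda> t = \<one>\<^bsub>H\<^esub>) \<longrightarrow>
       val H \<Lambda> (dw (?g \<otimes> eval_word G \<rho> w)) = val H \<Lambda> (dw ?g) \<otimes>\<^bsub>H\<^esub> val H \<Lambda> (dw (eval_word G \<rho> w))"
    using val_dw_mult[OF assms(1) g eval_word_closed[of \<rho> w, OF \<rho>]] by (elim exE conjE)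
  show ?case
  proof (rule exI[of _ "B \<union> C"], intro conjI allI impI)
    show "finite (B \<union> C)" using B C by simp
    show "card (B \<union> C) \<le> length (l # w) * (6 * (K + 1))"
      using card_Un_le[of B C] B(2) C(2) by simp
    fix \<Lambda> assume \<Lambda>: "\<forall>t. \<Lambda> t \<in> carrier H" "\<forall>t\<in>B \<union> C. \<Lambda> t = \<one>\<^bsub>H\<^esub>"
    have "val H \<Lambda> (dw ?g) = (if fst l then inv\<^bsub>H\<^esub> val H \<Lambda> (dw (\<rho> (snd l))) else val H \<Lambda> (dw (\<rho> (snd l))))"
      using val_dw_inv[OF assms(1), of \<Lambda>] \<Lambda>(1) \<rho> by simp
    then show "val H \<Lambda> (dw (eval_word G \<rho> (l # w))) = eval_word H (\<lambda>i. val H \<Lambda> (dw (\<rho> i))) (l # w)"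
      using B'[rule_format, of \<Lambda>, OF \<Lambda>(1)[rule_format] \<Lambda>(2)[rule_format, OF UnI1]]
        C'[rule_format, of \<Lambda>, OF \<Lambda>(1)[rule_format] \<Lambda>(2)[rule_format, OF UnI2]]
      unfolding eval_word_Cons by simp
  qed
qed

text \<open>A generic value of a universal variable carries \<open>M\<close> consecutive types, all too long to
  occur in the values chosen before. Which of them the variable gets is decided only after the
  play, when the boundedly many types crossing a cut in the evaluation of the equations are known.\<close>

definition generic_at :: "nat \<Rightarrow> (nat \<Rightarrow> 'g) \<Rightarrow> nat \<Rightarrow> nat \<Rightarrow> bool" where
  "generic_at M \<rho> c j \<longleftrightarrow> map fst (dw (\<rho> j)) = u_word [2*c..<2*c+2*M] \<and> 0 < c \<and>
     (\<forall>i<j. length (dw (\<rho> i)) \<le> c)"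

text \<open>Universal variables receive generic elements, existential ones the witnesses supplied by
  satisfaction in \<open>G\<close>. The outcome is one assignment, with a threshold \<open>c\<close>
  for each variable.\<close>

lemma generic_play:
  assumes "sat G qs n \<rho> D" and "\<And>i. \<rho> i \<in> carrier G"
  shows "\<exists>\<rho>' c. (\<forall>i. \<rho>' i \<in> carrier G) \<and> (\<forall>i<n. \<rho>' i = \<rho> i) \<and> holds_matrix G \<rho>' D \<and>
    (\<forall>j<length qs. qs ! j = QAll \<longrightarrow> generic_at M \<rho>' (c (n + j)) (n + j))"
  using assms
proof (induction qs arbitrary: n \<rho>)
  case Nil
  then show ?case by (intro exI[of _ \<rho>]) auto
next
  case (Cons a qs)
  have IH: "\<exists>\<rho>' c. (\<forall>i. \<rho>' i \<in> carrier G) \<and> (\<forall>i<Suc n. \<rho>' i = (\<rho>(n := x)) i) \<and> holds_matrix G \<rho>' D \<and>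
      (\<forall>j<length qs. qs ! j = QAll \<longrightarrow> generic_at M \<rho>' (c (Suc n + j)) (Suc n + j))"
    if "x \<in> carrier G" "sat G qs (Suc n) (\<rho>(n := x)) D" for x
    by (rule Cons.IH[OF that(2)]) (use that(1) Cons.prems(2) in simp)
  show ?case
  proof (cases a)
    case QEx
    with Cons.prems obtain x where "x \<in> carrier G" "sat G qs (Suc n) (\<rho>(n := x)) D" by auto
    from IH[OF this] obtain \<rho>' c where
      c: "\<And>i. \<rho>' i \<in> carrier G" "\<And>i. i < Suc n \<Longrightarrow> \<rho>' i = (\<rho>(n := x)) i" "holds_matrix G \<rho>' D"
      "\<And>j. j < length qs \<Longrightarrow> qs ! j = QAll \<Longrightarrow> generic_at M \<rho>' (c (Suc n + j)) (Suc n + j)" by blast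
    have "generic_at M \<rho>' (c (n + j)) (n + j)" if "j < length (a # qs)" "(a # qs) ! j = QAll" for j
      using that QEx c(4)[of "j - 1"] by (cases j) auto
    moreover have "\<forall>i<n. \<rho>' i = \<rho> i" using c(2) by simp
    ultimately show ?thesis using c(1,3) by (intro exI[of _ \<rho>'] exI[of _ c]) blast
  next
    case QAll
    \<comment> \<open>The sum bounds the length of every earlier word, and the successor makes all
      exponents positive.\<close>
    define c0 where "c0 = Suc (\<Sum>i<n. length (dw (\<rho> i)))"
    have "0 < c0" by (simp add: c0_def)
    then obtain x where x: "x \<in> carrier G" "map fst (dw x) = u_word [2*c0..<2*c0+2*M]"
      using dw_u_word[of "[2*c0..<2*c0+2*M]"] by fastforce
    have "sat G qs (Suc n) (\<rho>(n := x)) D" using Cons.prems(1) QAll x(1) by simp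
    from IH[OF x(1) this] obtain \<rho>' c where
      c: "\<And>i. \<rho>' i \<in> carrier G" "\<And>i. i < Suc n \<Longrightarrow> \<rho>' i = (\<rho>(n := x)) i" "holds_matrix G \<rho>' D"
      "\<And>j. j < length qs \<Longrightarrow> qs ! j = QAll \<Longrightarrow> generic_at M \<rho>' (c (Suc n + j)) (Suc n + j)" by blast
    have old: "\<forall>i<n. \<rho>' i = \<rho> i" using c(2) by simp
    have "length (dw (\<rho>' i)) \<le> c0" if "i < n" for i
    proof -
      have "length (dw (\<rho> i)) \<le> (\<Sum>i<n. length (dw (\<rho> i)))"
        by (rule member_le_sum) (use that in auto)
      with old that show ?thesis by (simp add: c0_def)
    qed
    moreover have "\<rho>' n = x" using c(2)[of n] by simp
    ultimately have "generic_at M \<rho>' c0 n" using x(2) \<open>0 < c0\<close> unfolding generic_at_def by blast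
    then have "generic_at M \<rho>' ((c(n := c0)) (n + j)) (n + j)"
      if "j < length (a # qs)" "(a # qs) ! j = QAll" for j
      using that QAll c(4)[of "j - 1"] by (cases j) auto
    with old c(1,3) show ?thesis by (intro exI[of _ \<rho>'] exI[of _ "c(n := c0)"]) blast
  qed
qed

text \<open>With \<open>\<rho>\<close> a finished play in \<open>G\<close>, the strategy in
  \<open>H\<close> answers an existential variable \<open>i\<close> by the value of
  \<open>dw (\<rho> i)\<close>. By \<open>new\<close>, the types of later universal variables are
  too large to occur in that word, so the answer depends only on moves already made. The induction
  keeps the answers below \<open>n\<close> consistent with this rule, and \<open>final\<close>
  handles complete plays.\<close>

lemma sat_transfer:
  fixes H :: "('h, 'c) monoid_scheme" and qs :: "quant list" and \<tau> :: "nat \<Rightarrow> nat" and \<rho> :: "nat \<Rightarrow> 'g"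
  defines "L \<equiv> spread \<tau> (universals qs) (\<one>\<^bsub>H\<^esub>)"
  assumes H: "group H"
    and inj: "inj_on \<tau> (universals qs)"
    and new: "\<And>i j. j \<in> universals qs \<Longrightarrow> i < j \<Longrightarrow> length (dw (\<rho> i)) \<le> \<tau> j"
    and final: "\<And>\<sigma>. (\<And>i. \<sigma> i \<in> carrier H) \<Longrightarrow>
        (\<And>i. i < length qs \<Longrightarrow> i \<notin> universals qs \<Longrightarrow> \<sigma> i = val H (L \<sigma>) (dw (\<rho> i))) \<Longrightarrow> holds_matrix H \<sigma> D"
  shows "drop n qs = rs \<Longrightarrow> n \<le> length qs \<Longrightarrow> (\<And>i. \<sigma> i \<in> carrier H) \<Longrightarrow>
    (\<And>i. i < n \<Longrightarrow> i \<notin> universals qs \<Longrightarrow> \<sigma> i = val H (L \<sigma>) (dw (\<rho> i))) \<Longrightarrow> sat H rs n \<sigma> D"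
proof (induction rs arbitrary: n \<sigma>)
  case Nil
  then show ?case using final[of \<sigma>] by simp
next
  case (Cons a rs)
  interpret H: group H by fact
  have n': "n < length qs" using Cons.prems(1) by (metis drop_eq_Nil list.discI not_less)
  have "qs ! n # drop (Suc n) qs = a # rs" using Cons.prems(1) n' by (simp add: Cons_nth_drop_Suc)
  then have n: "n < length qs" "qs ! n = a" "drop (Suc n) qs = rs" using n' by auto
  have LE: "L (\<sigma>(n := x)) t = L \<sigma> t" if "n \<in> universals qs \<Longrightarrow> t \<noteq> \<tau> n" for t x
  proof (cases "t \<in> \<tau> ` universals qs")
    case True
    then obtain i where "i \<in> universals qs" "t = \<tau> i" by blast
    with that show ?thesis by (cases "i = n") (auto simp: L_def spread_in[OF inj])
  qed (simp add: L_def spread_notin)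
  have LC: "L \<sigma> t \<in> carrier H" for t
    using Cons.prems(3) by (simp add: L_def spread_def)
  show ?case
  proof (cases a)
    case QAll
    have "sat H rs (Suc n) (\<sigma>(n := x)) D" if "x \<in> carrier H" for x
    proof (rule Cons.IH)
      fix i assume i: "i < Suc n" "i \<notin> universals qs"
      with QAll n have "i < n" by (metis (mono_tags, lifting) less_SucE mem_Collect_eq universals_def)
      \<comment> \<open>The new move changes only the value of the type \<open>\<tau> n\<close>,
        which is too large for the words of earlier variables.\<close>
      have "val H (L (\<sigma>(n := x))) (dw (\<rho> i)) = val H (L \<sigma>) (dw (\<rho> i))"
      proof (rule val_cong, rule LE)
        fix t assume "t < length (dw (\<rho> i))"
        moreover assume "n \<in> universals qs"
        ultimately show "t \<noteq> \<tau> n" using new[of n i] \<open>i < n\<close> by auto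
      qed
      then show "(\<sigma>(n := x)) i = val H (L (\<sigma>(n := x))) (dw (\<rho> i))"
        using Cons.prems(4)[OF \<open>i < n\<close> i(2)] \<open>i < n\<close> by simp
    qed (use n that Cons.prems(3) in auto)
    with QAll show ?thesis by simp
  next
    case QEx
    let ?x = "val H (L \<sigma>) (dw (\<rho> n))"
    have x: "?x \<in> carrier H" by (rule H.val_closed[OF LC])
    \<comment> \<open>An existential variable reserves no type, so answering it leaves the values of
      all types unchanged.\<close>
    have "L (\<sigma>(n := ?x)) t = L \<sigma> t" for t by (rule LE) (use QEx n in \<open>simp add: universals_def\<close>)
    then have eq: "L (\<sigma>(n := ?x)) = L \<sigma>" by auto
    have "sat H rs (Suc n) (\<sigma>(n := ?x)) D"
    proof (rule Cons.IH)
      fix i assume "i < Suc n" "i \<notin> universals qs"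
      then show "(\<sigma>(n := ?x)) i = val H (L (\<sigma>(n := ?x))) (dw (\<rho> i))"
        using Cons.prems(4)[of i] unfolding eq by auto
    qed (use n x Cons.prems(3) in auto)
    with QEx show ?thesis by (auto intro: bexI[OF _ x])
  qed
qed

theorem holds_transfer:
  fixes H :: "('h, 'c) monoid_scheme"
  assumes H: "group H" and pos: "positive_sentence s" and G: "holds G s"
  shows "holds H s"
proof -
  interpret H: group H by fact
  obtain qs D where s: "s = (qs, D)" by (cases s)
  \<comment> \<open>The number of types is needed before the play, but the disjunct that holds is
    known only after it; the bound therefore adds up over all disjuncts.\<close>
  define B0 where "B0 = sum_list (map (\<lambda>C. sum_list (map (\<lambda>w. length w * (6 * (K + 1))) C)) D)"
  define M where "M = Suc B0"
  have "sat G qs 0 (\<lambda>_. \<one>) D" using G by (simp add: holds_def s)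
  from generic_play[OF this, of M] obtain \<rho> c where
    \<rho>: "\<And>i. \<rho> i \<in> carrier G" and hm: "holds_matrix G \<rho> D"
    and "\<And>j. j \<in> universals qs \<Longrightarrow> generic_at M \<rho> (c j) j"
    unfolding universals_def by auto
  then have c: "\<And>j. j \<in> universals qs \<Longrightarrow> map fst (dw (\<rho> j)) = u_word [2 * c j..<2 * c j + 2 * M]"
      "\<And>j. j \<in> universals qs \<Longrightarrow> 0 < c j"
      "\<And>i j. j \<in> universals qs \<Longrightarrow> i < j \<Longrightarrow> length (dw (\<rho> i)) \<le> c j"
    unfolding generic_at_def by blast+
  from hm obtain C where C: "C \<in> set D" "\<And>w. w \<in> set C \<Longrightarrow> eval_word G \<rho> w = \<one>"
    by (auto simp: holds_matrix_def)
  have "\<exists>B. finite B \<and> card B \<le> sum_list (map (\<lambda>w. length w * (6 * (K + 1))) C') \<and>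
     (\<forall>\<Lambda>. (\<forall>t. \<Lambda> t \<in> carrier H) \<longrightarrow> (\<forall>t\<in>B. \<Lambda> t = \<one>\<^bsub>H\<^esub>) \<longrightarrow> (\<forall>w\<in>set C'.
       val H \<Lambda> (dw (eval_word G \<rho> w)) = eval_word H (\<lambda>i. val H \<Lambda> (dw (\<rho> i))) w))" for C'
  proof (induction C')
    case Nil
    show ?case by (rule exI[of _ "{}"]) simp
  next
    case (Cons w C')
    then obtain B where B: "finite B" "card B \<le> sum_list (map (\<lambda>w. length w * (6 * (K + 1))) C')"
      and BV: "\<forall>\<Lambda>. (\<forall>t. \<Lambda> t \<in> carrier H) \<longrightarrow> (\<forall>t\<in>B. \<Lambda> t = \<one>\<^bsub>H\<^esub>) \<longrightarrow> (\<forall>w\<in>set C'.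
       val H \<Lambda> (dw (eval_word G \<rho> w)) = eval_word H (\<lambda>i. val H \<Lambda> (dw (\<rho> i))) w)"
      by (elim exE conjE)
    from val_eval_word[where \<rho> = \<rho> and w = w, OF H \<rho>] obtain B' where B': "finite B'" "card B' \<le> length w * (6 * (K + 1))"
      and BV': "\<forall>\<Lambda>. (\<forall>t. \<Lambda> t \<in> carrier H) \<longrightarrow> (\<forall>t\<in>B'. \<Lambda> t = \<one>\<^bsub>H\<^esub>) \<longrightarrow>
       val H \<Lambda> (dw (eval_word G \<rho> w)) = eval_word H (\<lambda>i. val H \<Lambda> (dw (\<rho> i))) w"
      by (elim exE conjE)
    have "card (B' \<union> B) \<le> sum_list (map (\<lambda>w. length w * (6 * (K + 1))) (w # C'))"
      using card_Un_le[of B' B] B(2) B'(2) by simp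
    moreover have "val H \<Lambda> (dw (eval_word G \<rho> v)) = eval_word H (\<lambda>i. val H \<Lambda> (dw (\<rho> i))) v"
      if "\<forall>t. \<Lambda> t \<in> carrier H" "\<forall>t\<in>B' \<union> B. \<Lambda> t = \<one>\<^bsub>H\<^esub>" "v \<in> set (w # C')" for \<Lambda> v
    proof -
      have "\<forall>t\<in>B'. \<Lambda> t = \<one>\<^bsub>H\<^esub>" "\<forall>t\<in>B. \<Lambda> t = \<one>\<^bsub>H\<^esub>" using that(2) by simp_all
      from BV[rule_format, OF that(1)[rule_format] this(2)[rule_format]]
        BV'[rule_format, OF that(1)[rule_format] this(1)[rule_format]] that(3)
      show ?thesis by auto
    qed
    ultimately show ?case using B(1) B'(1)
      by (intro exI[of _ "B' \<union> B"] conjI allI impI ballI) simp_all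
  qed
  from this[of C] obtain B where B: "finite B" "card B \<le> sum_list (map (\<lambda>w. length w * (6 * (K + 1))) C)"
    and BV: "\<forall>\<Lambda>. (\<forall>t. \<Lambda> t \<in> carrier H) \<longrightarrow> (\<forall>t\<in>B. \<Lambda> t = \<one>\<^bsub>H\<^esub>) \<longrightarrow> (\<forall>w\<in>set C.
       val H \<Lambda> (dw (eval_word G \<rho> w)) = eval_word H (\<lambda>i. val H \<Lambda> (dw (\<rho> i))) w)"
    by (elim exE conjE)
  have "sum_list (map (\<lambda>w. length w * (6 * (K + 1))) C) \<le> B0"
    unfolding B0_def by (rule member_le_sum_list) (use C(1) in auto)
  with B(2) have "card B < M" by (simp add: M_def)
  \<comment> \<open>Pigeonhole: each variable offers \<open>M\<close> types and fewer than
    \<open>M\<close> are bad.\<close>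
  have "\<exists>t. t \<in> {c j..<c j + M} - B" for j
  proof -
    have "\<not> {c j..<c j + M} \<subseteq> B"
      using card_mono[OF B(1), of "{c j..<c j + M}"] \<open>card B < M\<close> by auto
    then show ?thesis by blast
  qed
  then obtain \<tau> where \<tau>: "\<And>j. c j \<le> \<tau> j" "\<And>j. \<tau> j < c j + M" "\<And>j. \<tau> j \<notin> B"
    by (metis DiffE atLeastLessThan_iff)
  \<comment> \<open>The word of \<open>i\<close> contains a block of length
    \<open>2 * c i + 2 * M - 1\<close>, and \<open>c j\<close> is at least the length of that word.
    So different universal variables have disjoint ranges of types.\<close>
  have apart: "c i + M \<le> c j" if "i < j" "i \<in> universals qs" "j \<in> universals qs" for i j
  proof -
    have "2 * c i + 2 * B0 + 1 \<in> set [2 * c i..<2 * c i + 2 * M]" by (simp add: M_def)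
    from length_u_word_ge[OF this] have "2 * c i + 2 * B0 + 1 < length (map fst (dw (\<rho> i)))"
      using c(1)[of i] that by simp
    with c(3)[of j i] that show ?thesis by (simp add: M_def)
  qed
  let ?U = "universals qs"
  let ?L = "spread \<tau> ?U (\<one>\<^bsub>H\<^esub>)"
  have inj: "i = j" if "i \<in> ?U" "j \<in> ?U"
    "c i \<le> \<tau> j" "\<tau> j < c i + M" for i j
    using apart[of i j] apart[of j i] \<tau>(1,2)[of j] that by linarith
  have inj': "inj_on \<tau> ?U"
  proof (rule inj_onI)
    fix i j assume "i \<in> ?U" "j \<in> ?U" "\<tau> i = \<tau> j"
    with inj[of i j] \<tau>(1,2)[of i] show "i = j" by simp
  qed
  have "sat H qs 0 (\<lambda>_. \<one>\<^bsub>H\<^esub>) D"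
  proof (rule sat_transfer[OF H inj'])
    fix i j assume "j \<in> ?U" "i < j"
    with c(3)[of j i] \<tau>(1)[of j] show "length (dw (\<rho> i)) \<le> \<tau> j" by simp
  next
    fix \<sigma> assume \<sigma>: "\<And>i. \<sigma> i \<in> carrier H"
      and ex: "\<And>i. i < length qs \<Longrightarrow> i \<notin> ?U \<Longrightarrow> \<sigma> i = val H (?L \<sigma>) (dw (\<rho> i))"
    have LC: "?L \<sigma> t \<in> carrier H" for t using \<sigma> by (simp add: spread_def)
    have LB: "?L \<sigma> t = \<one>\<^bsub>H\<^esub>" if "t \<in> B" for t using that \<tau>(3) by (intro spread_notin) auto
    \<comment> \<open>The word of \<open>i\<close> meets the reserved type \<open>\<tau> i\<close>
      once and no type reserved for another variable, so its value is the opponent's move.\<close>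
    have all: "val H (?L \<sigma>) (dw (\<rho> i)) = \<sigma> i" if i: "i \<in> ?U" for i
    proof -
      have "val H (?L \<sigma>) (dw (\<rho> i)) = ?L \<sigma> (\<tau> i)"
      proof (rule H.val_u_word[OF LC coherent_dw[OF \<rho>] c(2)[OF i] c(1)[OF i] \<tau>(1,2)])
        fix t assume t: "c i \<le> t" "t < c i + M" "t \<noteq> \<tau> i"
        then have "t \<notin> \<tau> ` ?U" using inj[OF i] by auto
        then show "?L \<sigma> t = \<one>\<^bsub>H\<^esub>" by (rule spread_notin)
      next
        \<comment> \<open>Type 0 has to stay trivial because \<open>val_u_word\<close> does not
          exclude its backward occurrences.\<close>
        have "0 < \<tau> j" if "j \<in> ?U" for j using c(2)[OF that] \<tau>(1)[of j] by simp
        then have "0 \<notin> \<tau> ` ?U" by force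
        then show "?L \<sigma> 0 = \<one>\<^bsub>H\<^esub>" by (rule spread_notin)
      qed
      then show ?thesis using spread_in[OF inj' i] by simp
    qed
    have eq: "\<sigma> i = val H (?L \<sigma>) (dw (\<rho> i))" if "i < length qs" for i
      using all[of i] ex[OF that] by (cases "i \<in> ?U") simp_all
    have "eval_word H \<sigma> w = \<one>\<^bsub>H\<^esub>" if "w \<in> set C" for w
    proof -
      have "\<forall>l\<in>set w. snd l < length qs"
        using pos C(1) that by (auto simp: positive_sentence_def s)
      then have "eval_word H \<sigma> w = eval_word H (\<lambda>i. val H (?L \<sigma>) (dw (\<rho> i))) w"
      proof (induction w)
        case (Cons l w)
        then have "eval_word H \<sigma> w = eval_word H (\<lambda>i. val H (?L \<sigma>) (dw (\<rho> i))) w" by simp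
        moreover have "\<sigma> (snd l) = val H (?L \<sigma>) (dw (\<rho> (snd l)))" using Cons.prems by (intro eq) simp
        ultimately show ?case unfolding eval_word_Cons by simp
      qed (simp add: eval_word_def)
      also have "\<dots> = val H (?L \<sigma>) (dw (eval_word G \<rho> w))"
        using BV[rule_format, of "?L \<sigma>", OF LC LB that] by simp
      \<comment> \<open>The equation holds in \<open>G\<close>, so the value on the left is that of
        the empty word.\<close>
      finally show ?thesis using C(2)[OF that] by (simp add: dw_one val_def)
    qed
    then show "holds_matrix H \<sigma> D" using C(1) by (auto simp: holds_matrix_def)
  qed simp_all
  then show ?thesis by (simp add: holds_def s)
qed

end

section \<open>The free group of rank 2\<close>

definition linv :: "f2letter \<Rightarrow> f2letter" where
  "linv x = (\<not> fst x, snd x)"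

lemma linv_linv [simp]: "linv (linv x) = x"
  by (simp add: linv_def)

fun reduced :: "f2letter list \<Rightarrow> bool" where
  "reduced [] = True"
| "reduced [x] = True"
| "reduced (x # y # ys) = (y \<noteq> linv x \<and> reduced (y # ys))"

lemma reduced_tl: "reduced (x # xs) \<Longrightarrow> reduced xs"
  by (cases xs) auto

text \<open>Left multiplication of a reduced word by a letter, which is the recursion step of
  \<open>free_red\<close>. Associativity will rest on its invertibility
  \<open>push_linv\<close>.\<close>

definition push :: "f2letter \<Rightarrow> f2letter list \<Rightarrow> f2letter list" where
  "push x w = (case w of [] \<Rightarrow> [x] | y # ys \<Rightarrow> if y = linv x then ys else x # w)"

lemma free_red_Cons: "free_red (x # w) = push x (free_red w)"
  by (auto simp: push_def linv_def prod_eq_iff split: list.splits)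

declare free_red.simps(2) [simp del]

lemma reduced_push: "reduced w \<Longrightarrow> reduced (push x w)"
  by (auto simp: push_def reduced_tl split: list.splits)

lemma reduced_free_red: "reduced (free_red w)"
  by (induction w) (auto simp: free_red_Cons reduced_push)

lemma push_reduced: "reduced (x # w) \<Longrightarrow> push x w = x # w"
  by (cases w) (auto simp: push_def)

lemma free_red_reduced: "reduced w \<Longrightarrow> free_red w = w"
proof (induction w)
  case (Cons x w)
  then show ?case using reduced_tl[OF Cons.prems] by (simp add: free_red_Cons push_reduced)
qed simp

lemma carrier_F2: "carrier F2 = {w. reduced w}"
  unfolding F2_def using reduced_free_red free_red_reduced by (auto, metis)

lemma push_linv: "reduced w \<Longrightarrow> push x (push (linv x) w) = w"
  by (cases w) (auto simp: push_def split: list.splits dest: push_reduced)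

lemma free_red_append_right: "free_red (x @ free_red y) = free_red (x @ y)"
  by (induction x) (simp_all add: free_red_Cons free_red_reduced reduced_free_red)

text \<open>The only delicate case is a letter that cancels against the head of the reduced tail;
  there \<open>push a\<close> and \<open>push (linv a)\<close> undo each other.\<close>

lemma free_red_append_left: "free_red (free_red x @ y) = free_red (x @ y)"
proof (induction x)
  case (Cons a x)
  show ?case
  proof (cases "\<exists>ys. free_red x = linv a # ys")
    case True
    then obtain ys where ys: "free_red x = linv a # ys" by blast
    have "free_red (a # x @ y) = push a (push (linv a) (free_red (ys @ y)))"
      using Cons.IH by (simp add: ys free_red_Cons)
    then show ?thesis by (simp add: free_red_Cons ys push_def push_linv[OF reduced_free_red, unfolded push_def])
  next
    case False
    then have "free_red (a # x) = a # free_red x"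
      by (auto simp: free_red_Cons push_def split: list.splits)
    then show ?thesis using Cons.IH by (simp add: free_red_Cons)
  qed
qed simp

definition winv :: "f2letter list \<Rightarrow> f2letter list" where
  "winv w = rev (map linv w)"

lemma winv_winv [simp]: "winv (winv w) = w"
  by (simp add: winv_def rev_map o_def)

lemma free_red_winv: "free_red (w @ winv w) = []"
proof (induction w rule: rev_induct)
  case (snoc x w)
  have "free_red ((w @ [x]) @ winv (w @ [x])) = free_red (w @ free_red (x # linv x # winv w))"
    by (simp add: winv_def free_red_append_right)
  also have "free_red (x # linv x # winv w) = free_red (winv w)"
    by (simp add: free_red_Cons push_linv reduced_free_red)
  also have "free_red (w @ free_red (winv w)) = []"
    using snoc by (simp add: free_red_append_right)
  finally show ?case .
qed (simp add: winv_def)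

lemma reduced_iff: "reduced w \<longleftrightarrow> (\<forall>i. Suc i < length w \<longrightarrow> w ! Suc i \<noteq> linv (w ! i))"
proof (induction w rule: reduced.induct)
  case (3 x y ys)
  then show ?case by (auto simp: nth_Cons split: nat.splits)
qed auto

lemma reduced_winv:
  assumes "reduced w" shows "reduced (winv w)"
  unfolding reduced_iff
proof (intro allI impI)
  fix i assume i: "Suc i < length (winv w)"
  let ?j = "length w - Suc (Suc i)"
  have j: "Suc ?j < length w" "length w - Suc i = Suc ?j" using i by (auto simp: winv_def)
  have "winv w ! Suc i = linv (w ! ?j)" "winv w ! i = linv (w ! Suc ?j)"
    using i j by (simp_all add: winv_def rev_nth)
  moreover have "w ! Suc ?j \<noteq> linv (w ! ?j)" using assms j by (simp add: reduced_iff)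
  ultimately show "winv w ! Suc i \<noteq> linv (winv w ! i)" by simp
qed

lemma F2_simps: "x \<otimes>\<^bsub>F2\<^esub> y = free_red (x @ y)" "\<one>\<^bsub>F2\<^esub> = []"
  by (simp_all add: F2_def)

lemma group_F2: "group F2"
proof (rule groupI)
  fix x assume x: "x \<in> carrier F2"
  then have "winv x \<in> carrier F2" "winv x \<otimes>\<^bsub>F2\<^esub> x = \<one>\<^bsub>F2\<^esub>"
    using reduced_winv free_red_winv[of "winv x"] by (simp_all add: carrier_F2 F2_simps)
  then show "\<exists>y\<in>carrier F2. y \<otimes>\<^bsub>F2\<^esub> x = \<one>\<^bsub>F2\<^esub>" by blast
qed (simp_all add: carrier_F2 F2_simps reduced_free_red free_red_reduced free_red_append_left
    free_red_append_right)

lemma inv_F2: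
  assumes "w \<in> carrier F2" shows "inv\<^bsub>F2\<^esub> w = winv w"
proof -
  interpret group F2 by (rule group_F2)
  show ?thesis
  proof (rule inv_equality)
    show "winv w \<otimes>\<^bsub>F2\<^esub> w = \<one>\<^bsub>F2\<^esub>" using free_red_winv[of "winv w"] by (simp add: F2_simps)
    show "winv w \<in> carrier F2" using assms by (simp add: carrier_F2 reduced_winv)
  qed (rule assms)
qed

text \<open>The tripod of the free group: all cancellation happens along \<open>q\<close>. A further
  letter \<open>a\<close> cancels only if \<open>p\<close> is empty and \<open>r\<close> starts with
  its inverse, since \<open>a # u\<close> is reduced.\<close>

lemma free_red_cancel:
  assumes "reduced u" "reduced v"
  shows "\<exists>p q r. u = p @ q \<and> v = winv q @ r \<and> free_red (u @ v) = p @ r"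
  using assms
proof (induction u)
  case Nil
  then show ?case by (intro exI[of _ "[]"] exI[of _ v]) (simp add: winv_def free_red_reduced)
next
  case (Cons a u)
  then obtain p q r where 1: "u = p @ q" "v = winv q @ r" "free_red (u @ v) = p @ r"
    using reduced_tl by blast
  then have eq: "free_red ((a # u) @ v) = push a (p @ r)" by (simp add: free_red_Cons)
  show ?case
  proof (cases "p = [] \<and> (\<exists>r'. r = linv a # r')")
    case True
    then obtain r' where "p = []" "r = linv a # r'" by blast
    then show ?thesis using 1 eq
      by (intro exI[of _ "[]"] exI[of _ "a # q"] exI[of _ r']) (simp add: winv_def push_def)
  next
    case False
    have "push a (p @ r) = a # p @ r"
      using False Cons.prems(1) 1(1) by (cases p; cases r) (auto simp: push_def)
    then show ?thesis using 1 eq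
      by (intro exI[of _ "a # p"] exI[of _ q] exI[of _ r]) simp
  qed
qed

text \<open>Inverse generators get \<open>Lc\<close>, so the pairs \<open>(La, Lb)\<close> and
  \<open>(Lb, La)\<close> never arise and the first alternative of coherence holds.\<close>

definition f2_label :: "f2letter \<Rightarrow> label" where
  "f2_label x = (if fst x then Lc else if snd x then Lb else La)"

definition f2_word :: "f2letter list \<Rightarrow> (label \<times> label) list" where
  "f2_word w = map (\<lambda>x. (f2_label x, f2_label (linv x))) w"

text \<open>Here a letter depends on a single generator, so nothing is read across the centre of a
  tripod and the constant is 0.\<close>

interpretation F2: labelled_group F2 f2_word 0
proof (intro labelled_group.intro labelled_group_axioms.intro group_F2)
  have opp: "f2_word (winv w) = opp (f2_word w)" for w
    by (simp add: f2_word_def winv_def opp_def rev_map o_def)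
  show "f2_word \<one>\<^bsub>F2\<^esub> = []" by (simp add: F2_simps f2_word_def)
  show "f2_word (inv\<^bsub>F2\<^esub> g) = opp (f2_word g)" if "g \<in> carrier F2" for g
    using that by (simp add: inv_F2 opp)
  show "\<exists>P X Q Y R Z. f2_word g = P @ X @ Q \<and> f2_word h = opp Q @ Y @ R \<and>
      f2_word (g \<otimes>\<^bsub>F2\<^esub> h) = P @ Z @ R \<and> length X \<le> 0 \<and> length Y \<le> 0 \<and> length Z \<le> 0"
    if "g \<in> carrier F2" "h \<in> carrier F2" for g h
  proof -
    from free_red_cancel[of g h] that obtain p q r where
      "g = p @ q" "h = winv q @ r" "free_red (g @ h) = p @ r" by (auto simp: carrier_F2)
    then show ?thesis
      by (intro exI[of _ "f2_word p"] exI[of _ "[]"] exI[of _ "f2_word q"] exI[of _ "f2_word r"])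
        (simp add: F2_simps opp[symmetric], simp add: f2_word_def)
  qed
  show "coherent (\<Union>g\<in>carrier F2. set (f2_word g))"
  proof -
    have "(f2_label x, f2_label (linv x)) \<noteq> (La, Lb)" "(f2_label x, f2_label (linv x)) \<noteq> (Lb, La)" for x
      by (cases "fst x"; simp add: f2_label_def linv_def)+
    then have "z \<noteq> (La, Lb) \<and> z \<noteq> (Lb, La)" if "z \<in> (\<Union>g\<in>carrier F2. set (f2_word g))" for z
    proof -
      from that obtain x where "z = (f2_label x, f2_label (linv x))"
        unfolding f2_word_def set_map by blast
      with \<open>\<And>x. (f2_label x, f2_label (linv x)) \<noteq> (La, Lb)\<close>
        \<open>\<And>x. (f2_label x, f2_label (linv x)) \<noteq> (Lb, La)\<close> show ?thesis by metis
    qed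
    then show ?thesis unfolding coherent_def by blast
  qed
  show "\<exists>g\<in>carrier F2. map fst (f2_word g) = u_word es" for es
  proof (rule bexI)
    let ?w = "map (\<lambda>l. (False, l = Lb)) (u_word es)"
    show "?w \<in> carrier F2" by (simp add: carrier_F2 reduced_iff linv_def)
    show "map fst (f2_word ?w) = u_word es"
      using set_u_word[of es] by (auto simp: f2_word_def o_def f2_label_def intro!: map_idI)
  qed
qed

text \<open>Both directions are instances of the same transfer, with target \<open>F2\<close> and
  with target \<open>G\<close>.\<close>

theorem (in labelled_group) trivial_positive_theory: "trivial_positive_theory G"
  unfolding trivial_positive_theory_def
  using holds_transfer[OF group_F2] F2.holds_transfer[OF is_group] by blast

section \<open>Paths and windows in trees\<close>

definition gpath :: "('v \<times> 'v) set \<Rightarrow> 'v list \<Rightarrow> 'v \<Rightarrow> 'v \<Rightarrow> bool" where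
  "gpath E xs p q \<longleftrightarrow> walk E xs \<and> distinct xs \<and> hd xs = p \<and> last xs = q"

lemma walk_iff: "walk E xs \<longleftrightarrow> xs \<noteq> [] \<and> successively (\<lambda>x y. (x, y) \<in> E) xs"
  by (simp add: walk_def successively_conv_nth)

locale tree =
  fixes V :: "'v set" and E :: "('v \<times> 'v) set"
  assumes tree: "simplicial_tree V E"
begin

lemma sym_E: "(x, y) \<in> E \<longleftrightarrow> (y, x) \<in> E"
  using tree by (auto simp: simplicial_tree_def sym_def)

lemma E_subset: "(x, y) \<in> E \<Longrightarrow> x \<in> V \<and> y \<in> V"
  using tree by (auto simp: simplicial_tree_def)

lemma walk_rev: "walk E (rev xs) \<longleftrightarrow> walk E xs"
  by (simp add: walk_iff sym_E)

lemma gpath_rev: "gpath E xs p q \<Longrightarrow> gpath E (rev xs) q p"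
  by (auto simp: gpath_def walk_rev hd_rev last_rev)

lemma walk_in_V: "walk E xs \<Longrightarrow> hd xs \<in> V \<Longrightarrow> set xs \<subseteq> V"
proof (induction xs)
  case (Cons x xs)
  then show ?case
    by (cases xs) (auto simp: walk_iff dest: E_subset)
qed simp

lemma gpath_in_V: "gpath E xs p q \<Longrightarrow> p \<in> V \<Longrightarrow> set xs \<subseteq> V"
  unfolding gpath_def using walk_in_V by blast

text \<open>If the first steps differ, the reverse of one path followed by the other is a walk
  without backtracking. The tree axiom makes it distinct, although it meets \<open>q\<close>
  twice.\<close>

lemma gpath_unique:
  assumes "gpath E xs p q" "gpath E ys p q"
  shows "xs = ys"
  using assms
proof (induction xs arbitrary: ys p)
  case Nil
  then show ?case by (simp add: gpath_def walk_def)
next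
  case (Cons x xs)
  from Cons.prems obtain ys' where ys: "ys = p # ys'" "x = p"
    by (cases ys) (auto simp: gpath_def walk_def)
  show ?case
  proof (cases "xs = [] \<or> ys' = []")
    case True
    then show ?thesis using Cons.prems ys
      by (auto simp: gpath_def split: if_splits)
  next
    case False
    then obtain a xs' b ys'' where xs: "xs = a # xs'" and ys': "ys' = b # ys''"
      by (metis neq_Nil_conv)
    have tl: "gpath E xs a q" "gpath E ys' b q"
      using Cons.prems by (auto simp: gpath_def walk_iff xs ys ys')
    show ?thesis
    proof (cases "a = b")
      case True
      then show ?thesis using Cons.IH[OF tl(1)] tl(2) ys by simp
    next
      case ab: False
      let ?z = "rev xs @ p # ys'"
      have z: "walk E ?z"
      proof -
        have "walk E (rev xs)" "walk E (p # ys')" "(a, p) \<in> E" "last (rev xs) = a"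
          using Cons.prems tl walk_rev[of xs] by (auto simp: gpath_def ys walk_iff xs sym_E last_rev)
        then show ?thesis by (auto simp: walk_iff successively_append_iff)
      qed
      have d: "distinct (rev xs @ [p])" "distinct (p # ys')"
        using Cons.prems by (auto simp: gpath_def ys)
      \<comment> \<open>Three consecutive vertices lie on the first path, are centred at the turning
        point \<open>p\<close>, or lie on the second path.\<close>
      have "?z ! i \<noteq> ?z ! (i + 2)" if i: "i + 2 < length ?z" for i
      proof -
        consider "i + 2 \<le> length xs" | "i + 1 = length xs" | j where "i = length xs + j"
          by (metis Suc_eq_plus1 add_2_eq_Suc' le_SucE le_Suc_ex not_less_eq_eq)
        then show ?thesis
        proof cases
          case 1
          have "(rev xs @ [p]) ! i \<noteq> (rev xs @ [p]) ! (i + 2)"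
            using d(1) 1 by (subst nth_eq_iff_index_eq) auto
          with 1 show ?thesis by (auto simp: nth_append)
        next
          case 2
          then have "?z ! i = a" "?z ! (i + 2) = b"
            by (auto simp: nth_append rev_nth xs ys')
          with ab show ?thesis by simp
        next
          case (3 j)
          have "(p # ys') ! j \<noteq> (p # ys') ! (j + 2)"
            using d(2) 3 i by (subst nth_eq_iff_index_eq) auto
          with 3 show ?thesis by (simp add: nth_append)
        qed
      qed
      then have "distinct ?z" using tree z unfolding simplicial_tree_def by blast
      moreover have "q \<in> set xs" "q \<in> set ys'"
        using tl unfolding gpath_def walk_def by (metis last_in_set)+
      ultimately show ?thesis by auto
    qed
  qed
qed

lemma walk_to_gpath: "walk E xs \<Longrightarrow> \<exists>ys. gpath E ys (hd xs) (last xs)"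
proof (induction xs rule: length_induct)
  case (1 xs)
  show ?case
  proof (cases "distinct xs")
    case True
    with 1 show ?thesis by (auto simp: gpath_def)
  next
    case False
    then obtain as bs cs y where xs: "xs = as @ [y] @ bs @ [y] @ cs"
      using not_distinct_decomp by blast
    let ?zs = "as @ [y] @ cs"
    have "walk E ?zs" using 1(2) unfolding xs walk_iff
      by (auto simp: successively_append_iff successively_Cons)
    moreover have "length ?zs < length xs" by (simp add: xs)
    moreover have "hd ?zs = hd xs" "last ?zs = last xs" by (auto simp: xs hd_append)
    ultimately show ?thesis using 1(1) by metis
  qed
qed

definition path :: "'v \<Rightarrow> 'v \<Rightarrow> 'v list" where
  "path p q = (THE xs. gpath E xs p q)"

lemma path_eq: "gpath E xs p q \<Longrightarrow> path p q = xs"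
  unfolding path_def using gpath_unique by (intro the_equality)

lemma gpath_path:
  assumes "p \<in> V" "q \<in> V" shows "gpath E (path p q) p q"
proof -
  have "connected_in V E" using tree by (simp add: simplicial_tree_def)
  with assms obtain xs where "walk E xs" "hd xs = p" "last xs = q"
    unfolding connected_in_def by blast
  with walk_to_gpath obtain ys where "gpath E ys p q" by blast
  with path_eq show ?thesis by metis
qed

text \<open>The centre \<open>m\<close> is the first vertex of the path from \<open>p\<close> to
  \<open>q\<close> that lies on the path from \<open>q\<close> to \<open>r\<close>. Then
  \<open>A\<close> avoids the latter path, so \<open>A @ m # C\<close> is again a geodesic;
  uniqueness identifies the common leg.\<close>

lemma tripod:
  assumes "p \<in> V" "q \<in> V" "r \<in> V"
  shows "\<exists>A m B C. path p q = A @ m # B \<and> path q r = rev B @ m # C \<and> path p r = A @ m # C"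
proof -
  note g = gpath_path[OF assms(1,2)] gpath_path[OF assms(2,3)]
  have "q \<in> set (path p q) \<and> q \<in> set (path q r)"
    using g unfolding gpath_def walk_def by (metis hd_in_set last_in_set)
  then have "\<exists>x\<in>set (path p q). x \<in> set (path q r)" by blast
  from split_list_first_prop[OF this] obtain A m B where
    1: "path p q = A @ m # B" "m \<in> set (path q r)" "\<forall>y\<in>set A. y \<notin> set (path q r)" by blast
  obtain B' C where 2: "path q r = B' @ m # C" using split_list[OF 1(2)] by blast
  have "gpath E (m # B) m q" "gpath E (B' @ [m]) q m"
    using g unfolding 1 2 by (auto simp: gpath_def walk_iff successively_append_iff hd_append)
  with gpath_unique gpath_rev have "rev (m # B) = B' @ [m]" by blast
  then have B': "B' = rev B" by simp
  have "gpath E (A @ m # C) p r"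
    using g 1(3) unfolding 1(1) 2
    by (auto simp: gpath_def walk_iff successively_append_iff hd_append)
  with 1 2 B' path_eq show ?thesis by blast
qed

end

section \<open>Windows with a fixed number of orbit vertices\<close>

definition positions :: "'v set \<Rightarrow> 'v list \<Rightarrow> nat list" where
  "positions S J = filter (\<lambda>i. J ! i \<in> S) [0..<length J]"

text \<open>With \<open>S\<close> the orbit of \<open>v\<close>, these are the subsegments of
  o-length \<open>k\<close> in order. A path with at most \<open>k\<close> orbit vertices has none,
  whereas the index range in \<open>fstar\<close> is never empty.\<close>

definition windows :: "'v set \<Rightarrow> nat \<Rightarrow> 'v list \<Rightarrow> 'v list list" where
  "windows S k J = (let p = positions S J in
     map (\<lambda>j. segment J (p ! j) (p ! (j + k))) [0..<length p - k])"

lemma positions_append: "positions S (A @ B) = positions S A @ map (\<lambda>i. length A + i) (positions S B)"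
proof -
  have "[0..<length (A @ B)] = [0..<length A] @ map (\<lambda>i. length A + i) [0..<length B]"
    using upt_add_eq_append[of 0 "length A" "length B"] map_add_upt[of "length A" "length B"]
    by (simp add: add.commute)
  moreover have "filter (\<lambda>i. (A @ B) ! i \<in> S) [0..<length A] = positions S A"
    unfolding positions_def by (rule filter_cong) (auto simp: nth_append)
  ultimately show ?thesis by (simp add: positions_def filter_map o_def)
qed

lemma positions_rev: "positions S (rev J) = rev (map (\<lambda>i. length J - 1 - i) (positions S J))"
proof -
  have "[0..<length J] = rev (map (\<lambda>i. length J - 1 - i) [0..<length J])"
    by (rule nth_equalityI) (auto simp: rev_nth)
  then have "positions S (rev J) = filter (\<lambda>i. rev J ! i \<in> S) (rev (map (\<lambda>i. length J - 1 - i) [0..<length J]))"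
    by (simp add: positions_def)
  also have "\<dots> = rev (map (\<lambda>i. length J - 1 - i) (filter (\<lambda>i. rev J ! (length J - 1 - i) \<in> S) [0..<length J]))"
    by (simp add: rev_filter[symmetric] filter_map o_def)
  also have "filter (\<lambda>i. rev J ! (length J - 1 - i) \<in> S) [0..<length J] = positions S J"
    unfolding positions_def by (rule filter_cong) (auto simp: rev_nth)
  finally show ?thesis .
qed

lemma positions_map:
  assumes "\<And>x. x \<in> set J \<Longrightarrow> h x \<in> S \<longleftrightarrow> x \<in> S"
  shows "positions S (map h J) = positions S J"
  unfolding positions_def using assms by (auto intro!: filter_cong)

lemma positions_nth:
  assumes "j < length (positions S J)"
  shows "positions S J ! j < length J" "J ! (positions S J ! j) \<in> S"
  using nth_mem[OF assms] by (auto simp: positions_def)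

lemma sorted_positions: "sorted_wrt (<) (positions S J)"
  unfolding positions_def by (intro sorted_wrt_filter sorted_wrt_upt)

lemma positions_mono:
  assumes "i \<le> j" "j < length (positions S J)"
  shows "positions S J ! i \<le> positions S J ! j"
  using assms sorted_wrt_nth_less[OF sorted_positions[of S J], of i j]
  by (cases "i = j") auto

lemma segment_map: "segment (map h J) a b = map h (segment J a b)"
  by (simp add: segment_def take_map drop_map)

lemma segment_rev:
  assumes "a \<le> b" "b < length J"
  shows "segment (rev J) (length J - 1 - b) (length J - 1 - a) = rev (segment J a b)"
proof (rule nth_equalityI)
  show "length (segment (rev J) (length J - 1 - b) (length J - 1 - a)) = length (rev (segment J a b))"
    using assms by (simp add: segment_def)
  fix i assume "i < length (segment (rev J) (length J - 1 - b) (length J - 1 - a))"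
  then have i: "i < Suc b - a" using assms by (simp add: segment_def)
  then have "segment (rev J) (length J - 1 - b) (length J - 1 - a) ! i = J ! (b - i)"
    using assms by (simp add: segment_def rev_nth)
  moreover have "rev (segment J a b) ! i = J ! (b - i)"
    using i assms by (simp add: segment_def rev_nth)
  ultimately show "segment (rev J) (length J - 1 - b) (length J - 1 - a) ! i = rev (segment J a b) ! i"
    by simp
qed

lemma windows_map:
  assumes "\<And>x. x \<in> set J \<Longrightarrow> h x \<in> S \<longleftrightarrow> x \<in> S"
  shows "windows S k (map h J) = map (map h) (windows S k J)"
  using positions_map[OF assms] by (simp add: windows_def Let_def segment_map)

lemma windows_rev: "windows S k (rev J) = rev (map rev (windows S k J))"
proof -
  let ?p = "positions S J" and ?r = "positions S (rev J)" and ?n = "length J"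
  have l: "length ?r = length ?p" by (simp add: positions_rev)
  show ?thesis
  proof (rule nth_equalityI)
    show "length (windows S k (rev J)) = length (rev (map rev (windows S k J)))"
      by (simp add: windows_def Let_def l)
    fix j assume "j < length (windows S k (rev J))"
    then have j: "j + k < length ?p" by (simp add: windows_def Let_def l)
    let ?i = "length ?p - k - Suc j"
    have r: "?r ! j = ?n - 1 - ?p ! (?i + k)" "?r ! (j + k) = ?n - 1 - ?p ! ?i"
      using j by (simp_all add: positions_rev rev_nth add.commute)
    have "[0..<length ?p - k] ! j = j" using j by simp
    then have "windows S k (rev J) ! j = segment (rev J) (?r ! j) (?r ! (j + k))"
      using j by (simp add: windows_def Let_def l)
    also have "\<dots> = rev (segment J (?p ! ?i) (?p ! (?i + k)))"
      unfolding r
      by (rule segment_rev) (use j positions_mono[of ?i "?i + k" S J] positions_nth(1)[of "?i + k" S J] in simp_all)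
    also have "\<dots> = rev (map rev (windows S k J)) ! j"
      using j by (simp add: windows_def Let_def rev_nth)
    finally show "windows S k (rev J) ! j = rev (map rev (windows S k J)) ! j" .
  qed
qed

lemma segment_append_left: "b < length A \<Longrightarrow> segment (A @ B) a b = segment A a b"
  by (cases "a \<le> length A") (auto simp: segment_def)

lemma segment_append_right: "segment (A @ B) (length A + a) (length A + b) = segment B a b"
  by (simp add: segment_def)

text \<open>A window that lies in neither piece starts in \<open>A\<close> and ends in
  \<open>B\<close>. Its last orbit vertex is \<open>k\<close> places after its first, so there are
  at most \<open>k\<close> of these.\<close>

lemma windows_split:
  assumes "0 < k"
  shows "\<exists>X. windows S k (A @ m # B) = windows S k (A @ [m]) @ X @ windows S k (m # B) \<and> length X \<le> k"
proof -
  let ?J = "A @ m # B"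
  let ?p = "positions S ?J" and ?p1 = "positions S (A @ [m])" and ?p2 = "positions S (m # B)"
  let ?a = "length (positions S A)" and ?l1 = "length ?p1"
  let ?W = "\<lambda>j. segment ?J (?p ! j) (?p ! (j + k))"
  have p1: "?p = ?p1 @ map (\<lambda>i. length (A @ [m]) + i) (positions S B)"
    using positions_append[of S "A @ [m]" B] by simp
  have p2: "?p = positions S A @ map (\<lambda>i. length A + i) ?p2"
    by (rule positions_append)
  have "length (positions S [m]) \<le> 1" unfolding positions_def using length_filter_le[of _ "[0..<length [m]]"] by simp
  then have l1: "?a \<le> ?l1" "?l1 \<le> ?a + 1" by (simp_all add: positions_append)
  have le: "?l1 \<le> length ?p" "length ?p = ?a + length ?p2" using p1 p2 by (metis le_add1 length_append, metis length_append length_map)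
  have e1: "map ?W [0..<?l1 - k] = windows S k (A @ [m])"
  proof -
    have "?W j = segment (A @ [m]) (?p1 ! j) (?p1 ! (j + k))" if "j < ?l1 - k" for j
    proof -
      have "?p ! j = ?p1 ! j" "?p ! (j + k) = ?p1 ! (j + k)"
        using that unfolding p1 by (auto simp: nth_append)
      moreover have "?p1 ! (j + k) < length (A @ [m])" using that by (intro positions_nth(1)) simp
      ultimately show ?thesis using segment_append_left[of "?p1 ! (j + k)" "A @ [m]" B] by simp
    qed
    then show ?thesis by (auto simp: windows_def Let_def)
  qed
  have e2: "map (\<lambda>j. ?W (?a + j)) [0..<length ?p2 - k] = windows S k (m # B)"
  proof -
    have "?W (?a + j) = segment (m # B) (?p2 ! j) (?p2 ! (j + k))" if "j < length ?p2 - k" for j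
    proof -
      have "?p ! (?a + j) = length A + ?p2 ! j" "?p ! (?a + j + k) = length A + ?p2 ! (j + k)"
        using that unfolding p2 by (auto simp: nth_append add.assoc)
      then show ?thesis by (simp add: segment_append_right)
    qed
    then show ?thesis by (auto simp: windows_def Let_def)
  qed
  \<comment> \<open>The indices whose window starts in \<open>A\<close> and ends beyond
    \<open>m\<close>. The minimum covers short paths, where the windows run out before the starts in
    \<open>A\<close> do and \<open>m # B\<close> has none.\<close>
  let ?X = "map ?W [?l1 - k..<min ?a (length ?p - k)]"
  have "[0..<length ?p - k] = [0..<?l1 - k] @ [?l1 - k..<min ?a (length ?p - k)] @ map (\<lambda>j. ?a + j) [0..<length ?p2 - k]"
  proof -
    have "[0..<length ?p - k] = [0..<min ?a (length ?p - k)] @ map (\<lambda>j. ?a + j) [0..<length ?p2 - k]"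
    proof (cases "?a \<le> length ?p - k")
      case True
      then have "length ?p - k = ?a + (length ?p2 - k)" using le by simp
      then show ?thesis using upt_add_eq_append[of 0 ?a "length ?p2 - k"] True map_add_upt[of ?a "length ?p2 - k"]
        by (simp add: add.commute)
    next
      case False
      then have "length ?p2 - k = 0" using le by simp
      with False show ?thesis by (simp add: min_def)
    qed
    moreover have "[0..<min ?a (length ?p - k)] = [0..<?l1 - k] @ [?l1 - k..<min ?a (length ?p - k)]"
    proof -
      have "?l1 - k \<le> ?a" using l1 assms by linarith
      moreover have "?l1 - k \<le> length ?p - k" using le(1) by (rule diff_le_mono)
      ultimately have "?l1 - k \<le> min ?a (length ?p - k)" by simp
      then obtain d where "min ?a (length ?p - k) = ?l1 - k + d" using le_Suc_ex by blast
      then show ?thesis using upt_add_eq_append[of 0 "?l1 - k" d] by simp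
    qed
    ultimately show ?thesis by simp
  qed
  then have "windows S k ?J = windows S k (A @ [m]) @ ?X @ windows S k (m # B)"
    unfolding e1[symmetric] e2[symmetric] by (simp add: windows_def Let_def o_def)
  moreover have "length ?X \<le> k" using l1 by simp
  ultimately show ?thesis by blast
qed

lemma windows_elim:
  assumes "K \<in> set (windows S k J)"
  obtains A B where "J = A @ K @ B" "K \<noteq> []" "hd K \<in> S" "last K \<in> S"
    "distinct J \<longrightarrow> card (set K \<inter> S) = Suc k"
proof -
  let ?p = "positions S J"
  from assms obtain j where j: "j + k < length ?p" and K: "K = segment J (?p ! j) (?p ! (j + k))"
    unfolding windows_def Let_def by (auto simp: less_diff_conv)
  let ?a = "?p ! j" and ?b = "?p ! (j + k)"
  have ab: "?a \<le> ?b" "?b < length J" using positions_mono[of j "j + k" S J] positions_nth(1)[OF j] j by auto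
  have "J = take ?a J @ K @ drop (Suc ?b - ?a) (drop ?a J)"
    unfolding K segment_def by (metis append_take_drop_id)
  moreover have nK: "length K = Suc ?b - ?a" using ab by (simp add: K segment_def)
  then have "K \<noteq> []" using ab by auto
  moreover have nth: "K ! i = J ! (?a + i)" if "i < Suc ?b - ?a" for i
    using that ab by (simp add: K segment_def)
  have "hd K \<in> S" "last K \<in> S"
    using nth[of 0] nth[of "?b - ?a"] ab nK \<open>K \<noteq> []\<close> positions_nth(2)[of j S J] positions_nth(2)[OF j] j
    by (simp_all add: hd_conv_nth last_conv_nth Suc_diff_le)
  moreover have "card (set K \<inter> S) = Suc k" if d: "distinct J"
  proof -
    have "set K \<inter> S = (\<lambda>i. J ! (?p ! i)) ` {j..j + k}"
    proof (intro equalityI subsetI)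
      fix x assume "x \<in> set K \<inter> S"
      then obtain i where i: "i < Suc ?b - ?a" "x = J ! (?a + i)" "x \<in> S"
        using nth nK by (auto simp: in_set_conv_nth)
      then have "?a + i \<in> set ?p" using ab by (auto simp: positions_def)
      then obtain l where l: "l < length ?p" "?p ! l = ?a + i" by (auto simp: in_set_conv_nth)
      have "\<not> l < j" using sorted_wrt_nth_less[OF sorted_positions[of S J], of l j] j l by auto
      moreover have "\<not> j + k < l" using sorted_wrt_nth_less[OF sorted_positions[of S J], of "j + k" l] i(1) l by auto
      ultimately show "x \<in> (\<lambda>i. J ! (?p ! i)) ` {j..j + k}"
        using i l by (intro image_eqI[of _ _ l]) auto
    next
      fix x assume "x \<in> (\<lambda>i. J ! (?p ! i)) ` {j..j + k}"
      then obtain l where l: "j \<le> l" "l \<le> j + k" "x = J ! (?p ! l)" by auto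
      then have "?a \<le> ?p ! l" "?p ! l \<le> ?b" using positions_mono[of j l S J] positions_mono[of l "j + k" S J] j by auto
      then have "x = K ! (?p ! l - ?a)" "?p ! l - ?a < length K" using nth[of "?p ! l - ?a"] l nK by auto
      then show "x \<in> set K \<inter> S" using positions_nth(2)[of l S J] l j by auto
    qed
    moreover have "inj_on (\<lambda>i. J ! (?p ! i)) {j..j + k}"
    proof (rule inj_onI)
      fix x y assume xy: "x \<in> {j..j + k}" "y \<in> {j..j + k}" "J ! (?p ! x) = J ! (?p ! y)"
      then have "x < length ?p" "y < length ?p" using j by auto
      then have "?p ! x = ?p ! y" using xy(3) d positions_nth(1)[of _ S J] by (simp add: nth_eq_iff_index_eq)
      moreover have "distinct ?p" by (simp add: positions_def)
      ultimately show "x = y" using \<open>x < length ?p\<close> \<open>y < length ?p\<close> by (simp add: nth_eq_iff_index_eq)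
    qed
    ultimately show ?thesis by (simp add: card_image)
  qed
  ultimately show thesis using that by blast
qed

lemma card_positions: "distinct J \<Longrightarrow> card (set J \<inter> S) = length (positions S J)"
proof -
  assume d: "distinct J"
  have "set J \<inter> S = (\<lambda>i. J ! i) ` set (positions S J)"
    by (auto simp: positions_def in_set_conv_nth)
  moreover have "inj_on (\<lambda>i. J ! i) (set (positions S J))"
    using d by (auto simp: inj_on_def positions_def nth_eq_iff_index_eq)
  moreover have "distinct (positions S J)" by (simp add: positions_def)
  ultimately show ?thesis by (simp only: card_image distinct_card)
qed

section \<open>Labelled actions on trees\<close>

definition dwords :: "('v list \<Rightarrow> label) \<Rightarrow> 'v set \<Rightarrow> nat \<Rightarrow> 'v list \<Rightarrow> (label \<times> label) list" where
  "dwords f S k J = map (\<lambda>K. (f K, f (rev K))) (windows S k J)"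

lemma dwords_rev: "dwords f S k (rev J) = opp (dwords f S k J)"
  by (simp add: dwords_def windows_rev opp_def rev_map o_def)

lemma dwords_split:
  assumes "0 < k"
  shows "\<exists>X. dwords f S k (A @ m # B) = dwords f S k (A @ [m]) @ X @ dwords f S k (m # B) \<and> length X \<le> k"
proof -
  obtain X where "windows S k (A @ m # B) = windows S k (A @ [m]) @ X @ windows S k (m # B)" "length X \<le> k"
    using windows_split[OF assms, of S A m B] by (elim exE conjE)
  then show ?thesis
    by (intro exI[of _ "map (\<lambda>K. (f K, f (rev K))) X"]) (simp add: dwords_def)
qed

locale labelled_tree = group G + tree V E
  for G :: "('g, 'b) monoid_scheme" (structure) and V :: "'v set" and E :: "('v \<times> 'v) set" +
  fixes \<phi> :: "'g \<Rightarrow> 'v \<Rightarrow> 'v" and v :: 'v and k :: nat and f :: "'v list \<Rightarrow> label"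
  assumes action: "tree_action_wo_inv G V E \<phi>"
    and v: "v \<in> V"
    and good: "good_labelling G V E \<phi> v k f"
begin

sublocale act: group_action G V \<phi>
  using action by (simp add: tree_action_wo_inv_def)

abbreviation "S \<equiv> vorbit G \<phi> v"
abbreviation "dword J \<equiv> dwords f S k J"

lemma act_E: "g \<in> carrier G \<Longrightarrow> (x, y) \<in> E \<Longrightarrow> (\<phi> g x, \<phi> g y) \<in> E"
  using action by (auto simp: tree_action_wo_inv_def)

lemma act_V: "g \<in> carrier G \<Longrightarrow> x \<in> V \<Longrightarrow> \<phi> g x \<in> V"
  using act.element_image by blast

lemma act_mult: "g \<in> carrier G \<Longrightarrow> h \<in> carrier G \<Longrightarrow> x \<in> V \<Longrightarrow> \<phi> (g \<otimes> h) x = \<phi> g (\<phi> h x)"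
  by (rule act.composition_rule)

lemma act_one: "x \<in> V \<Longrightarrow> \<phi> \<one> x = x"
  using fun_cong[OF act.id_eq_one, of x] by simp

lemma act_inv: "g \<in> carrier G \<Longrightarrow> x \<in> V \<Longrightarrow> \<phi> (inv g) (\<phi> g x) = x"
  using act_mult[of "inv g" g x] act_one by simp

lemma act_S:
  assumes "g \<in> carrier G" "x \<in> V" shows "\<phi> g x \<in> S \<longleftrightarrow> x \<in> S"
proof -
  have 1: "\<phi> h y \<in> S" if "h \<in> carrier G" "y \<in> S" for h y
  proof -
    from that(2) obtain h' where h': "h' \<in> carrier G" "y = \<phi> h' v" by (auto simp: vorbit_def)
    then have "\<phi> h y = \<phi> (h \<otimes> h') v" using act_mult that v by simp
    then show ?thesis using that(1) h'(1) unfolding vorbit_def by blast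
  qed
  show ?thesis
  proof
    assume "\<phi> g x \<in> S"
    from 1[OF inv_closed[OF assms(1)] this] show "x \<in> S" by (simp only: act_inv[OF assms])
  qed (rule 1[OF assms(1)])
qed

lemma walk_act:
  assumes "g \<in> carrier G" "walk E J" shows "walk E (map (\<phi> g) J)"
  using assms act_E by (auto simp: walk_def)

lemma gpath_act:
  assumes "g \<in> carrier G" "gpath E J p q" "p \<in> V"
  shows "gpath E (map (\<phi> g) J) (\<phi> g p) (\<phi> g q)"
proof -
  have "inj_on (\<phi> g) (set J)"
    by (rule inj_on_inverseI[of _ "\<phi> (inv g)"], rule act_inv[OF assms(1)])
      (use gpath_in_V[OF assms(2,3)] in blast)
  moreover have "J \<noteq> []" using assms(2) by (simp add: gpath_def walk_def)
  ultimately show ?thesis using walk_act[OF assms(1), of J] assms(2)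
    unfolding gpath_def by (simp add: distinct_map hd_map last_map)
qed

lemma path_act: "g \<in> carrier G \<Longrightarrow> p \<in> V \<Longrightarrow> q \<in> V \<Longrightarrow> path (\<phi> g p) (\<phi> g q) = map (\<phi> g) (path p q)"
  by (intro path_eq gpath_act gpath_path)

lemma k_pos: "0 < k"
  using good by (simp add: good_labelling_def)

lemma window_o_geod:
  assumes "gpath E J p q" "p \<in> V" "K \<in> set (windows S k J)"
  shows "K \<in> o_geods G V E \<phi> v k"
proof -
  from assms(3) obtain A B where 1: "J = A @ K @ B" "K \<noteq> []" "hd K \<in> S" "last K \<in> S"
    and "distinct J \<longrightarrow> card (set K \<inter> S) = Suc k" by (rule windows_elim)
  moreover have "distinct J" "walk E J" using assms(1) by (auto simp: gpath_def)
  ultimately have "card (set K \<inter> S) = Suc k" "walk E K" "distinct K"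
    by (auto simp: walk_iff successively_append_iff)
  then show ?thesis using 1 gpath_in_V[OF assms(1,2)]
    by (auto simp: o_geods_def o_geodesic_def o_length_def)
qed

lemma o_geods_rev: "K \<in> o_geods G V E \<phi> v n \<Longrightarrow> rev K \<in> o_geods G V E \<phi> v n"
  by (auto simp: o_geods_def o_geodesic_def o_length_def walk_rev hd_rev last_rev)

lemma f_act: "g \<in> carrier G \<Longrightarrow> K \<in> o_geods G V E \<phi> v k \<Longrightarrow> f (map (\<phi> g) K) = f K"
  using good by (simp add: good_labelling_def)

lemma dword_act:
  assumes "g \<in> carrier G" "gpath E J p q" "p \<in> V"
  shows "dword (map (\<phi> g) J) = dword J"
proof -
  have "windows S k (map (\<phi> g) J) = map (map (\<phi> g)) (windows S k J)"
    by (rule windows_map) (use act_S[OF assms(1)] gpath_in_V[OF assms(2,3)] in auto)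
  moreover have "f (map (\<phi> g) K) = f K \<and> f (rev (map (\<phi> g) K)) = f (rev K)"
    if "K \<in> set (windows S k J)" for K
    using window_o_geod[OF assms(2,3) that] f_act[OF assms(1)] o_geods_rev by (simp add: rev_map)
  ultimately show ?thesis by (simp add: dwords_def)
qed

text \<open>Condition (ii), applied also to reversed windows, is the first alternative. If it fails
  at \<open>J\<close>, single orbits make every window labelled \<open>La\<close> a translate of
  \<open>J\<close> and every one labelled \<open>Lb\<close> a translate of \<open>rev J\<close>, so
  reversal exchanges these labels.\<close>

lemma coherent_labels: "coherent ((\<lambda>K. (f K, f (rev K))) ` o_geods G V E \<phi> v k)"
proof -
  let ?O = "o_geods G V E \<phi> v k"
  show ?thesis
  proof (cases "\<forall>J\<in>?O. f J = La \<longrightarrow> f (rev J) \<noteq> Lb")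
    case True
    have "\<not> (f J = Lb \<and> f (rev J) = La)" if "J \<in> ?O" for J
      using True[rule_format, OF o_geods_rev[OF that]] by auto
    with True show ?thesis unfolding coherent_def by (intro disjI1) (auto simp: eq_commute)
  next
    case False
    then obtain J where J: "J \<in> ?O" "f J = La" "f (rev J) = Lb" by blast
    have c: "card (label_orbits G V E \<phi> v k f La) = 1" "card (label_orbits G V E \<phi> v k f Lb) = 1"
      using good False unfolding good_labelling_def by blast+
    have same: "\<exists>g\<in>carrier G. K = map (\<phi> g) L"
      if "K \<in> ?O" "L \<in> ?O" "f K = l" "f L = l" "card (label_orbits G V E \<phi> v k f l) = 1" for K L l
    proof -
      from that(5) obtain Z where "label_orbits G V E \<phi> v k f l = {Z}" by (metis card_1_singletonE)
      moreover have "geod_orbit G \<phi> K \<in> label_orbits G V E \<phi> v k f l"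
        "geod_orbit G \<phi> L \<in> label_orbits G V E \<phi> v k f l"
        unfolding label_orbits_def by (rule imageI, use that in simp)+
      ultimately have "geod_orbit G \<phi> K = geod_orbit G \<phi> L" by simp
      moreover have "map (\<phi> \<one>) K = K"
        using that(1) by (intro map_idI act_one) (auto simp: o_geods_def o_geodesic_def)
      then have "K \<in> geod_orbit G \<phi> K"
        unfolding geod_orbit_def by (intro CollectI exI[of _ \<one>]) simp
      ultimately show ?thesis unfolding geod_orbit_def by blast
    qed
    have swap: "f K = La \<longleftrightarrow> f (rev K) = Lb" if K: "K \<in> ?O" for K
    proof
      assume "f K = La"
      then obtain g where "g \<in> carrier G" "K = map (\<phi> g) J" using same[OF K J(1) _ J(2) c(1)] by blast
      then show "f (rev K) = Lb" using f_act[OF _ o_geods_rev[OF J(1)]] J(3) by (simp add: rev_map)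
    next
      assume "f (rev K) = Lb"
      then obtain g where "g \<in> carrier G" "rev K = map (\<phi> g) (rev J)"
        using same[OF o_geods_rev[OF K] o_geods_rev[OF J(1)] _ J(3) c(2)] by blast
      then have "g \<in> carrier G" "K = map (\<phi> g) J" by (auto simp: rev_map[symmetric])
      then show "f K = La" using f_act[OF _ J(1)] J(2) by simp
    qed
    have "f K = Lb \<longleftrightarrow> f (rev K) = La" if "K \<in> ?O" for K
      using swap[OF o_geods_rev[OF that]] by simp
    with swap show ?thesis unfolding coherent_def by simp
  qed
qed

definition gword :: "'g \<Rightarrow> (label \<times> label) list" where
  "gword g = dword (path v (\<phi> g v))"

lemma labelled_group_gword:
  assumes u: "\<forall>es. (\<forall>e\<in>set es. 0 < e) \<longrightarrow>
    (\<exists>N J. k \<le> N \<and> J \<in> o_geods G V E \<phi> v N \<and> fstar G \<phi> v k f J = u_word es)"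
  shows "labelled_group G gword k"
proof (unfold_locales)
  have "gpath E [v] v v" by (simp add: gpath_def walk_def)
  moreover have "windows S k [v] = []"
    using k_pos length_filter_le[of _ "[0..<length [v]]"] by (simp add: windows_def Let_def positions_def)
  ultimately show "gword \<one> = []"
    by (simp add: gword_def act_one v path_eq dwords_def)
next
  fix g assume g: "g \<in> carrier G"
  have gv: "\<phi> g v \<in> V" using act_V g v by simp
  have p: "gpath E (path v (\<phi> g v)) v (\<phi> g v)" by (rule gpath_path[OF v gv])
  \<comment> \<open>Translating by \<open>inv g\<close> carries the reversed path, from
    \<open>g v\<close> to \<open>v\<close>, to the path that defines
    \<open>gword (inv g)\<close>.\<close>
  have "path v (\<phi> (inv g) v) = map (\<phi> (inv g)) (path (\<phi> g v) v)"
    using path_act[of "inv g" "\<phi> g v" v] g gv v act_inv[OF g v] by simp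
  also have "path (\<phi> g v) v = rev (path v (\<phi> g v))" by (rule path_eq[OF gpath_rev[OF p]])
  finally show "gword (inv g) = opp (gword g)"
    using dword_act[OF inv_closed[OF g] gpath_rev[OF p] gv] by (simp add: gword_def dwords_rev)
next
  fix g h assume g: "g \<in> carrier G" and h: "h \<in> carrier G"
  have V: "\<phi> g v \<in> V" "\<phi> h v \<in> V" "\<phi> (g \<otimes> h) v \<in> V" using act_V g h v by simp_all
  obtain A m B C where t: "path v (\<phi> g v) = A @ m # B"
    "path (\<phi> g v) (\<phi> (g \<otimes> h) v) = rev B @ m # C" "path v (\<phi> (g \<otimes> h) v) = A @ m # C"
    using tripod[OF v V(1,3)] by blast
  \<comment> \<open>The side of the tripod from \<open>g v\<close> to \<open>g h v\<close> is a
    translate of the path of \<open>h\<close>, so it carries the same labels.\<close>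
  have "path (\<phi> g v) (\<phi> (g \<otimes> h) v) = map (\<phi> g) (path v (\<phi> h v))"
    using path_act[OF g v V(2)] act_mult[OF g h v] by simp
  then have 1: "gword g = dword (A @ m # B)" "gword h = dword (rev B @ m # C)"
    "gword (g \<otimes> h) = dword (A @ m # C)"
    using dword_act[OF g gpath_path[OF v V(2)] v] t by (simp_all add: gword_def)
  obtain X where "dword (A @ m # B) = dword (A @ [m]) @ X @ dword (m # B)" "length X \<le> k"
    using dwords_split[OF k_pos, of f S A m B] by (elim exE conjE)
  moreover obtain Y where "dword (rev B @ m # C) = dword (rev B @ [m]) @ Y @ dword (m # C)" "length Y \<le> k"
    using dwords_split[OF k_pos, of f S "rev B" m C] by (elim exE conjE)
  moreover obtain Z where "dword (A @ m # C) = dword (A @ [m]) @ Z @ dword (m # C)" "length Z \<le> k"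
    using dwords_split[OF k_pos, of f S A m C] by (elim exE conjE)
  moreover have "dword (rev B @ [m]) = opp (dword (m # B))"
    using dwords_rev[of f S k "m # B"] by simp
  ultimately show "\<exists>P X Q Y R Z. gword g = P @ X @ Q \<and> gword h = opp Q @ Y @ R \<and>
      gword (g \<otimes> h) = P @ Z @ R \<and> length X \<le> k \<and> length Y \<le> k \<and> length Z \<le> k"
    unfolding 1
    by (intro exI[of _ "dword (A @ [m])"] exI[of _ X] exI[of _ "dword (m # B)"] exI[of _ Y]
      exI[of _ "dword (m # C)"] exI[of _ Z]) simp
next
  show "coherent (\<Union>g\<in>carrier G. set (gword g))"
  proof (rule coherent_mono[OF coherent_labels], rule UN_least)
    fix g assume "g \<in> carrier G"
    then show "set (gword g) \<subseteq> (\<lambda>K. (f K, f (rev K))) ` o_geods G V E \<phi> v k"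
      using window_o_geod[OF gpath_path[OF v act_V[OF _ v]] v] by (auto simp: gword_def dwords_def)
  qed
next
  fix es :: "nat list" assume "\<forall>e\<in>set es. 0 < e"
  with u obtain N J where J: "k \<le> N" "J \<in> o_geods G V E \<phi> v N" "fstar G \<phi> v k f J = u_word es"
    by blast
  then have J': "walk E J" "distinct J" "set J \<subseteq> V" "hd J \<in> S" "last J \<in> S" "card (set J \<inter> S) - 1 = N"
    by (auto simp: o_geods_def o_geodesic_def o_length_def)
  then obtain g h where g: "g \<in> carrier G" "hd J = \<phi> g v" and h: "h \<in> carrier G" "last J = \<phi> h v"
    by (auto simp: vorbit_def)
  have gp: "gpath E J (\<phi> g v) (\<phi> h v)" using J' g h by (simp add: gpath_def)
  let ?x = "inv g \<otimes> h"
  have gv: "\<phi> g v \<in> V" using act_V[OF g(1) v] .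
  \<comment> \<open>The given geodesic need not start at \<open>v\<close>; translating its first
    vertex to \<open>v\<close> yields a group element with the same labels.\<close>
  have "gpath E (map (\<phi> (inv g)) J) v (\<phi> ?x v)"
    using gpath_act[OF inv_closed[OF g(1)] gp gv] act_inv[OF g(1) v] act_mult[OF inv_closed[OF g(1)] h(1) v] by simp
  then have "gword ?x = dword J"
    using path_eq dword_act[OF inv_closed[OF g(1)] gp gv] by (simp add: gword_def)
  moreover have "map fst (dword J) = fstar G \<phi> v k f J"
  proof -
    \<comment> \<open>Positivity of \<open>N\<close> undoes the truncated subtraction in
      \<open>o_length\<close>; then \<open>fstar\<close> and \<open>windows\<close> use the same
      index range.\<close>
    have "length (positions S J) = N + 1 \<and> 0 < N"
      using J'(6) J(1) k_pos card_positions[OF J'(2), of S] by simp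
    then have "o_length G \<phi> v J - k + 1 = length (positions S J) - k"
      using J(1) J'(6) by (simp add: o_length_def)
    then show ?thesis
      by (simp add: dwords_def windows_def fstar_def Let_def positions_def o_positions_def)
  qed
  ultimately show "\<exists>x\<in>carrier G. map fst (gword x) = u_word es"
    using J(3) g h by (intro bexI[of _ ?x]) simp_all
qed

end

theorem theoremA:
  fixes G :: "('g, 'b) monoid_scheme" and V :: "'v set" and E :: "('v \<times> 'v) set"
    and \<phi> :: "'g \<Rightarrow> 'v \<Rightarrow> 'v"
  assumes "group G"
    and "simplicial_tree V E"
    and "tree_action_wo_inv G V E \<phi>"
    and "weakly_acylindrical G V E \<phi>"
  shows "trivial_positive_theory G"
proof -
  from assms(4) obtain v k f where vkf: "v \<in> V" "good_labelling G V E \<phi> v k f"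
    "\<forall>es. (\<forall>e\<in>set es. 0 < e) \<longrightarrow>
      (\<exists>N J. k \<le> N \<and> J \<in> o_geods G V E \<phi> v N \<and> fstar G \<phi> v k f J = u_word es)"
    unfolding weakly_acylindrical_def by blast
  interpret labelled_tree G V E \<phi> v k f
    by (intro labelled_tree.intro labelled_tree_axioms.intro tree.intro assms vkf)
  show ?thesis by (rule labelled_group.trivial_positive_theory[OF labelled_group_gword[OF vkf(3)]])
qed

end
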